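(* Let $n\ge 1$, $d\ge 1$, and let $\eta^{(i)}_j\ge 0$ ($i,j\in[n]$) be fixed coefficients. Consider the party model: $n$ agents with opinions in $\mathbb{S}^{d-1}$ updated by $$\mathbf{X}_{t+1}^{(i)}=P_{\mathbb{S}^{d-1}}\Big(\mathbf{X}_t^{(i)}+\sum_{j:\,\mathrm{sgn}\langle\mathbf{X}_t^{(j)},\xi_t\rangle=\mathrm{sgn}\langle\mathbf{X}_t^{(i)},\xi_t\rangle}\eta^{(i)}_j\mathbf{X}_t^{(j)}-\sum_{j:\,\mathrm{sgn}\langle\mathbf{X}_t^{(j)},\xi_t\rangle\neq\mathrm{sgn}\langle\mathbf{X}_t^{(i)},\xi_t\rangle}\eta^{(i)}_j\mathbf{X}_t^{(j)}\Big),$$ where $\xi_0,\xi_1,\ldots$ are i.i.d. from a distribution $\mathcal{D}$ on $\mathbb{S}^{d-1}$ for which there exist $C,C'>0$ with $C\mu(B)\le\Pr(\xi_t\in B)\le C'\mu(B)$ for all measurable $B\subseteq\mathbb{S}^{d-1}$, $\mu$ being the uniform (Haar) probability measure. Let $A$ be the $n\times n$ matrix with $A_{ij}=1$ if $\eta^{(i)}_j>0$ and $A_{ij}=0$ otherwise, and suppose $A$ is irreducible, i.e., $A^n>0$ entrywise. Then for every starting configuration $\mathbf{X}_0\in(\mathbb{S}^{d-1})^n$, almost surely $\rho(\mathbf{X}_t,P)\to 0$ (the system strongly polarizes).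
   Context: $\mathbb{S}^{d-1}$ is the unit sphere in $\mathbb{R}^d$, $P_{\mathbb{S}^{d-1}}(\mathbf{x})=\mathbf{x}/\|\mathbf{x}\|_2$, $\mathrm{sgn}(0)=0$; as a standing assumption of the model, the unnormalized vector inside $P_{\mathbb{S}^{d-1}}$ is assumed nonzero so the normalization is well-defined. The polarized set is $P=\{(\sigma_1\mathbf{x},\ldots,\sigma_n\mathbf{x}):\mathbf{x}\in\mathbb{S}^{d-1},\ \bm{\sigma}\in\{-1,1\}^n\}$ and $\rho(\mathbf{z},P)=\inf_{\mathbf{y}\in P}\|\mathbf{z}-\mathbf{y}\|_2$ (Euclidean distance in $(\mathbb{R}^d)^n$). *)

theory Defs
  imports "HOL-Analysis.Analysis" "HOL-Probability.Probability"
begin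

text \<open>Configurations of n agents in R^d: the type real^'d^'n, whose norm is the
Euclidean norm on (R^d)^n.\<close>

definition sphere_proj :: "real^'d \<Rightarrow> real^'d" where
  "sphere_proj x = x /\<^sub>R norm x"

definition party_unnorm :: "('n::finite \<Rightarrow> 'n \<Rightarrow> real) \<Rightarrow> real^'d^'n \<Rightarrow> real^'d \<Rightarrow> 'n \<Rightarrow> real^'d" where
  "party_unnorm \<eta> X \<xi> i =
     X $ i
     + (\<Sum>j\<in>{j. sgn (inner (X $ j) \<xi>) = sgn (inner (X $ i) \<xi>)}. \<eta> i j *\<^sub>R X $ j)
     - (\<Sum>j\<in>{j. sgn (inner (X $ j) \<xi>) \<noteq> sgn (inner (X $ i) \<xi>)}. \<eta> i j *\<^sub>R X $ j)"

definition party_step :: "('n::finite \<Rightarrow> 'n \<Rightarrow> real) \<Rightarrow> real^'d^'n \<Rightarrow> real^'d \<Rightarrow> real^'d^'n" where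
  "party_step \<eta> X \<xi> = (\<chi> i. sphere_proj (party_unnorm \<eta> X \<xi> i))"

fun party_traj :: "('n::finite \<Rightarrow> 'n \<Rightarrow> real) \<Rightarrow> real^'d^'n \<Rightarrow> (nat \<Rightarrow> real^'d) \<Rightarrow> nat \<Rightarrow> real^'d^'n" where
  "party_traj \<eta> X0 xs 0 = X0"
| "party_traj \<eta> X0 xs (Suc t) = party_step \<eta> (party_traj \<eta> X0 xs t) (xs t)"

definition polarized_set :: "(real^'d^'n::finite) set" where
  "polarized_set = {(\<chi> i. \<sigma> i *\<^sub>R x) | x \<sigma>. x \<in> sphere 0 1 \<and> (\<forall>i. \<sigma> i \<in> {-1, 1})}"

text \<open>Uniform (normalized surface / Haar) probability measure of a Borel subset of
the unit sphere, given as the normalized cone measure.\<close>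
definition sphere_unif :: "(real^'d) set \<Rightarrow> real" where
  "sphere_unif B = measure lborel {r *\<^sub>R x | r x. 0 < r \<and> r \<le> 1 \<and> x \<in> B}
                   / measure lborel (cball (0::real^'d) 1)"

fun matpow :: "real^'n^'n \<Rightarrow> nat \<Rightarrow> real^'n^'n" where
  "matpow A 0 = mat 1"
| "matpow A (Suc k) = A ** matpow A k"

definition adj_matrix :: "('n::finite \<Rightarrow> 'n \<Rightarrow> real) \<Rightarrow> real^'n^'n" where
  "adj_matrix \<eta> = (\<chi> i j. if \<eta> i j > 0 then 1 else 0)"

end

theory Submission
  imports Defs
begin

text \<open>
  Let \<open>\<sigma>\<^sub>i\<close> be the sign of \<open>\<langle>X\<^sub>i, \<xi>\<rangle>\<close>. The flipped opinions \<open>Y\<^sub>i = \<sigma>\<^sub>i X\<^sub>i\<close> are replaced by the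
  normalizations of \<open>Y\<^sub>i + \<Sum>\<^sub>j \<eta>\<^sub>i\<^sub>j Y\<^sub>j\<close>. As long as the sign pattern stays constant up to a global
  flip, all \<open>Y\<^sub>i\<close> remain in a fixed circular cone around some \<open>e\<close>, and the rescaled vectors
  \<open>Y\<^sub>i / \<langle>Y\<^sub>i, e\<rangle>\<close> evolve by convex combinations; irreducibility makes their diameter contract by a
  constant factor every \<open>n\<close> steps. Two cases occur, for a small threshold \<open>\<epsilon>\<close>.

  If \<open>X\<close> is at distance \<open>r < \<epsilon>\<close> from the polarized set, only \<open>\<xi>\<close> in a band of width \<open>O(r)\<close> can break
  the sign pattern, so over one block of steps the distance drops to \<open>r / 4\<close> with probability
  \<open>1 - O(r)\<close>. If \<open>X\<close> is far away, choose \<open>e\<close> with all \<open>\<bar>\<langle>X\<^sub>i, e\<rangle>\<bar>\<close> bounded below; with probability bounded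
  below all \<open>\<xi>\<close> of a long block fall into a small cap around \<open>e\<close>, and then the distance drops to
  \<open>\<epsilon> / 2\<close>. Hence \<open>V = min 1 (\<rho> / \<epsilon>)\<close> satisfies \<open>E V(X\<^sub>t\<^sub>+\<^sub>T) \<le> c E V(X\<^sub>t)\<close> with \<open>c < 1\<close>, so
  \<open>\<Sum>\<^sub>t V(X\<^sub>t)\<close> has finite expectation and \<open>V(X\<^sub>t)\<close> tends to 0 almost surely.
\<close>

text \<open>Adding the identity absorbs the agent's own term \<open>X $ i\<close>, so that an
  aligned update becomes a single nonnegative combination with total weight at least 1.\<close>

definition lazy_weight :: "('n::finite \<Rightarrow> 'n \<Rightarrow> real) \<Rightarrow> 'n \<Rightarrow> 'n \<Rightarrow> real" where
  "lazy_weight \<eta> i j = (if i = j then 1 else 0) + \<eta> i j"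

text \<open>A positive entry of a matrix power is a walk in the influence graph. Some summand of the
  product must be positive, and this peels off the first edge.\<close>

lemma matpow_adj_Suc_pos:
  assumes "matpow (adj_matrix \<eta>) (Suc k) $ i $ j > 0"
  obtains l where "\<eta> i l > 0" "matpow (adj_matrix \<eta>) k $ l $ j > 0"
proof -
  have "\<exists>l. adj_matrix \<eta> $ i $ l * matpow (adj_matrix \<eta>) k $ l $ j > 0"
  proof (rule ccontr)
    assume "\<not> ?thesis"
    then have "(\<Sum>l\<in>UNIV. adj_matrix \<eta> $ i $ l * matpow (adj_matrix \<eta>) k $ l $ j) \<le> 0"
      by (intro sum_nonpos) (auto simp: not_less)
    with assms show False by (simp add: matrix_matrix_mult_def)
  qed
  then show ?thesis
    using that by (auto simp: adj_matrix_def split: if_splits)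
qed

subsection \<open>Contraction of iterated averages\<close>

context
  fixes \<eta> :: "'n::finite \<Rightarrow> 'n \<Rightarrow> real" and \<kappa> :: real and p :: "nat \<Rightarrow> 'n \<Rightarrow> 'n \<Rightarrow> real"
  assumes kappa: "0 < \<kappa>" "\<kappa> \<le> 1"
    and p_nonneg: "\<And>t i j. 0 \<le> p t i j"
    and p_sum: "\<And>t i. (\<Sum>j\<in>UNIV. p t i j) = 1"
    and p_adj: "\<And>t i j. 0 < \<eta> i j \<Longrightarrow> \<kappa> \<le> p t i j"
begin

lemma averaging_upper:
  fixes f :: "nat \<Rightarrow> 'n \<Rightarrow> real"
  assumes f: "\<And>t i. f (Suc t) i = (\<Sum>j\<in>UNIV. p t i j * f t j)"
    and B: "\<And>i. f t i \<le> B"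
  shows "f (t + k) i \<le> B"
proof (induction k arbitrary: i)
  case (Suc k)
  have "f (t + Suc k) i \<le> (\<Sum>j\<in>UNIV. p (t + k) i j * B)"
    unfolding add_Suc_right f by (intro sum_mono mult_left_mono Suc p_nonneg)
  also have "\<dots> = B" by (simp add: sum_distrib_right[symmetric] p_sum)
  finally show ?case .
qed (use B in simp)

text \<open>The deficit \<open>B - f\<close> is averaged by the same weights. Each edge of a walk
  from \<open>i\<close> to \<open>j\<close> passes back at least the fraction \<kappa> of the
  deficit at its end, and all other summands are nonnegative.\<close>

lemma averaging_upper_strict:
  fixes f :: "nat \<Rightarrow> 'n \<Rightarrow> real"
  assumes f: "\<And>t i. f (Suc t) i = (\<Sum>j\<in>UNIV. p t i j * f t j)"
    and B: "\<And>i. f t i \<le> B"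
    and reach: "matpow (adj_matrix \<eta>) k $ i $ j > 0"
  shows "f (t + k) i \<le> B - \<kappa> ^ k * (B - f t j)"
  using reach
proof (induction k arbitrary: i)
  case 0
  then show ?case by (auto simp: mat_def split: if_splits)
next
  case (Suc k)
  from Suc.prems obtain l where l: "\<eta> i l > 0" "matpow (adj_matrix \<eta>) k $ l $ j > 0"
    by (rule matpow_adj_Suc_pos)
  have "f (t + Suc k) i = B - (\<Sum>j\<in>UNIV. p (t + k) i j * (B - f (t + k) j))"
    by (simp add: f right_diff_distrib sum_subtractf sum_distrib_right[symmetric] p_sum)
  moreover have "p (t + k) i l * (B - f (t + k) l) \<le> (\<Sum>j\<in>UNIV. p (t + k) i j * (B - f (t + k) j))"
    using averaging_upper[of f, OF f B] p_nonneg by (intro member_le_sum) auto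
  moreover have "\<kappa> * (\<kappa> ^ k * (B - f t j)) \<le> p (t + k) i l * (B - f (t + k) l)"
    using Suc.IH[OF l(2)] p_adj[OF l(1)] kappa B[of j]
    by (intro mult_mono) (auto simp: p_nonneg)
  ultimately show ?case by simp
qed

text \<open>Every agent reaches an agent attaining the minimum by a walk of length \<open>k\<close>.
  So the maximum falls by at least \<kappa>^k times the spread, while the minimum cannot
  fall.\<close>

lemma averaging_oscillation:
  fixes f :: "nat \<Rightarrow> 'n \<Rightarrow> real"
  assumes f: "\<And>t i. f (Suc t) i = (\<Sum>j\<in>UNIV. p t i j * f t j)"
    and osc: "\<And>i j. f t i - f t j \<le> R"
    and reach: "\<And>i j. matpow (adj_matrix \<eta>) k $ i $ j > 0"
  shows "f (t + k) i - f (t + k) j \<le> (1 - \<kappa> ^ k) * R"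
proof -
  define B where "B = Max (range (f t))"
  define b where "b = Min (range (f t))"
  have B: "f t i \<le> B" for i unfolding B_def by (intro Max_ge) auto
  have b: "b \<le> f t i" for i unfolding b_def by (intro Min_le) auto
  have "b \<in> range (f t)" "B \<in> range (f t)"
    unfolding b_def B_def by (intro Min_in Max_in; simp)+
  then obtain m M where m: "b = f t m" and M: "B = f t M" by auto
  have upper: "f (t + k) i \<le> B - \<kappa> ^ k * (B - b)"
    unfolding m by (rule averaging_upper_strict[OF f B reach])
  have lower: "- f (t + k) j \<le> - b"
    by (rule averaging_upper[of "\<lambda>t i. - f t i"]) (auto simp: f sum_negf b)
  have "f (t + k) i - f (t + k) j \<le> (1 - \<kappa> ^ k) * (B - b)"
    using upper lower by (simp add: algebra_simps)
  also have "\<dots> \<le> (1 - \<kappa> ^ k) * R"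
    using osc[of M m] kappa m M by (intro mult_left_mono) (auto simp: power_le_one)
  finally show ?thesis .
qed

text \<open>Inner products with a fixed vector follow the scalar recursion. The direction used is
  that of the difference vector at the end of the block, whose norm it attains.\<close>

lemma averaging_diameter:
  fixes z :: "nat \<Rightarrow> 'n \<Rightarrow> 'a::real_inner"
  assumes z: "\<And>t i. z (Suc t) i = (\<Sum>j\<in>UNIV. p t i j *\<^sub>R z t j)"
    and diam: "\<And>i j. norm (z 0 i - z 0 j) \<le> R"
    and reach: "\<And>i j. matpow (adj_matrix \<eta>) k $ i $ j > 0"
  shows "norm (z (k * m) i - z (k * m) j) \<le> (1 - \<kappa> ^ k) ^ m * R"
proof (induction m arbitrary: i j)
  case 0
  then show ?case using diam by simp
next
  case (Suc m)
  define v where "v = z (k * m + k) i - z (k * m + k) j"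
  \<comment> \<open>For \<open>v = 0\<close> the value \<open>sgn 0 = 0\<close> still gives
    \<open>v \<bullet> u = norm v\<close>.\<close>
  define u where "u = sgn v"
  have u: "norm u \<le> 1" by (simp add: u_def norm_sgn)
  have "z (k * m + k) i \<bullet> u - z (k * m + k) j \<bullet> u \<le> (1 - \<kappa> ^ k) * ((1 - \<kappa> ^ k) ^ m * R)"
  proof (rule averaging_oscillation[of "\<lambda>t i. z t i \<bullet> u"])
    show "z (k * m) i \<bullet> u - z (k * m) j \<bullet> u \<le> (1 - \<kappa> ^ k) ^ m * R" for i j
    proof -
      have "(z (k * m) i - z (k * m) j) \<bullet> u \<le> norm (z (k * m) i - z (k * m) j) * norm u"
        by (rule norm_cauchy_schwarz)
      also have "\<dots> \<le> norm (z (k * m) i - z (k * m) j)"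
        using u by (simp add: mult_left_le)
      also note Suc
      finally show ?thesis by (simp add: inner_diff_left)
    qed
  qed (auto simp: z inner_sum_left reach)
  moreover have "v \<bullet> u = norm v"
    by (cases "v = 0") (simp_all add: u_def sgn_div_norm power2_norm_eq_inner[symmetric] power2_eq_square)
  ultimately show ?case
    by (simp add: v_def inner_diff_left add.commute mult.assoc)
qed

end

section \<open>Normalization, circular cones and the rescaled dynamics\<close>

lemma lazy_weight_nonneg: "(\<And>i j. 0 \<le> \<eta> i j) \<Longrightarrow> 0 \<le> lazy_weight \<eta> i j"
  by (simp add: lazy_weight_def)

lemma sum_lazy_weight_ge_1:
  assumes "\<And>i j. 0 \<le> \<eta> i j"
  shows "1 \<le> (\<Sum>j\<in>UNIV. lazy_weight \<eta> i j)"
  using assms by (simp add: lazy_weight_def sum.distrib sum_nonneg)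

lemma norm_sphere_proj: "x \<noteq> 0 \<Longrightarrow> norm (sphere_proj x) = 1"
  by (simp add: sphere_proj_def)

lemma sphere_proj_scaleR_pos: "0 < c \<Longrightarrow> sphere_proj (c *\<^sub>R x) = sphere_proj x"
  by (simp add: sphere_proj_def)

lemma sphere_proj_scaleR_sign: "\<sigma> \<in> {-1, 1} \<Longrightarrow> sphere_proj (\<sigma> *\<^sub>R x) = \<sigma> *\<^sub>R sphere_proj x"
  by (auto simp: sphere_proj_def)

text \<open>Outside the open unit ball the radial projection is the nearest-point projection onto
  the closed ball, which is 1-Lipschitz by convexity.\<close>

lemma sphere_proj_dist_le:
  fixes x y :: "real^'d"
  assumes "1 \<le> norm x" "1 \<le> norm y"
  shows "norm (sphere_proj x - sphere_proj y) \<le> norm (x - y)"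
proof -
  have cp: "closest_point (cball 0 1) v = sphere_proj v" if "1 \<le> norm v" for v :: "real^'d"
  proof (rule closest_point_unique[symmetric])
    show "sphere_proj v \<in> cball 0 1"
      using that norm_sphere_proj[of v] by (cases "v = 0") auto
    show "\<forall>z\<in>cball 0 1. dist v (sphere_proj v) \<le> dist v z"
    proof
      fix z :: "real^'d" assume z: "z \<in> cball 0 1"
      have "v - sphere_proj v = (1 - inverse (norm v)) *\<^sub>R v"
        by (simp add: sphere_proj_def algebra_simps)
      then have "dist v (sphere_proj v) = (1 - inverse (norm v)) * norm v"
        using that by (auto simp: dist_norm inverse_le_1_iff)
      also have "\<dots> = norm v - 1" using that by (subst left_diff_distrib, subst left_inverse) auto
      also have "\<dots> \<le> dist v z" using z norm_triangle_sub[of v z] by (simp add: dist_norm)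
      finally show "dist v (sphere_proj v) \<le> dist v z" .
    qed
  qed auto
  have "dist (closest_point (cball 0 1) x) (closest_point (cball 0 1) y) \<le> dist x y"
    by (rule closest_point_lipschitz) auto
  then show ?thesis using assms by (simp add: cp dist_norm)
qed

text \<open>Everything is compared with the total weight S: the height of the sum over
  \<open>e\<close> is at least a * S, its norm at most S. The quotient is therefore at least
  \<open>a\<close>, and S \<ge> 1 keeps the sum away from 0.\<close>

lemma convex_cone_step:
  fixes Y :: "'n::finite \<Rightarrow> real^'d"
  assumes eta: "\<And>i j. 0 \<le> \<eta> i j" and a: "0 < a"
    and Y: "\<And>j. norm (Y j) = 1" "\<And>j. a \<le> Y j \<bullet> e"
  defines "U \<equiv> \<lambda>i. \<Sum>j\<in>UNIV. lazy_weight \<eta> i j *\<^sub>R Y j"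
  shows "a \<le> U i \<bullet> e" "norm (sphere_proj (U i)) = 1" "a \<le> sphere_proj (U i) \<bullet> e"
proof -
  let ?S = "\<Sum>j\<in>UNIV. lazy_weight \<eta> i j"
  have w: "0 \<le> lazy_weight \<eta> i j" for i j using eta by (rule lazy_weight_nonneg)
  have S: "1 \<le> ?S" using eta by (rule sum_lazy_weight_ge_1)
  have 1: "a * ?S \<le> U i \<bullet> e"
    using Y(2) w
    by (auto simp: U_def inner_sum_left sum_distrib_left mult.commute[of a] intro!: sum_mono mult_left_mono)
  have 2: "norm (U i) \<le> ?S"
    unfolding U_def by (rule sum_norm_le) (use Y(1) w in auto)
  have "a * 1 \<le> a * ?S" using S a by (intro mult_left_mono) auto
  then show 3: "a \<le> U i \<bullet> e" using 1 by simp
  then have nz: "U i \<noteq> 0" using a by auto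
  then show "norm (sphere_proj (U i)) = 1" by (rule norm_sphere_proj)
  have "a * norm (U i) \<le> U i \<bullet> e"
    using 1 2 a by (meson mult_left_mono order_trans less_imp_le)
  then show "a \<le> sphere_proj (U i) \<bullet> e"
    using nz by (simp add: sphere_proj_def field_simps)
qed

text \<open>Dividing by the height over \<open>e\<close> makes the update projective: the
  normalizing factor cancels, and the rescaled vectors follow time-dependent stochastic matrices.
  The rate \<theta> is fixed before \<open>Y\<close>, \<open>e\<close> and \<open>a\<close>, so one
  rate serves all blocks.\<close>

lemma gauge_contraction:
  fixes \<eta> :: "'n::finite \<Rightarrow> 'n \<Rightarrow> real"
  assumes eta: "\<And>i j. 0 \<le> \<eta> i j"
    and irred: "\<And>i j. matpow (adj_matrix \<eta>) CARD('n) $ i $ j > 0"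
    and a0: "0 < a0"
  obtains \<theta> where "0 \<le> \<theta>" "\<theta> < 1"
    "\<And>(Y :: nat \<Rightarrow> 'n \<Rightarrow> real^'d) e a R m i j.
       \<lbrakk>a0 \<le> a; norm e = 1; \<And>t i. norm (Y t i) = 1; \<And>t i. a \<le> Y t i \<bullet> e;
        \<And>t i. Y (Suc t) i = sphere_proj (\<Sum>j\<in>UNIV. lazy_weight \<eta> i j *\<^sub>R Y t j);
        \<And>i j. norm (Y 0 i /\<^sub>R (Y 0 i \<bullet> e) - Y 0 j /\<^sub>R (Y 0 j \<bullet> e)) \<le> R\<rbrakk>
       \<Longrightarrow> norm (Y (CARD('n) * m) i - Y (CARD('n) * m) j) \<le> \<theta> ^ m * R"
proof -
  let ?w = "lazy_weight \<eta>"
  have w: "0 \<le> ?w i j" for i j using eta by (rule lazy_weight_nonneg)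
  define W where "W = (\<Sum>i\<in>UNIV. \<Sum>j\<in>UNIV. ?w i j)"
  have W: "(\<Sum>j\<in>UNIV. ?w i j) \<le> W" for i
    unfolding W_def by (rule member_le_sum) (auto intro!: sum_nonneg w)
  have W1: "1 \<le> W" by (rule order_trans[OF sum_lazy_weight_ge_1[of \<eta>] W]) (rule eta)
  define c where "c = Min (insert 1 {\<eta> i j | i j. 0 < \<eta> i j})"
  have fin: "finite {\<eta> i j | i j. 0 < \<eta> i j}"
    by (rule finite_subset[of _ "range (\<lambda>(i,j). \<eta> i j)"]) auto
  have c: "0 < c" "c \<le> 1" and c_le: "0 < \<eta> i j \<Longrightarrow> c \<le> \<eta> i j" for i j
    unfolding c_def using fin by (auto intro!: Min_le)
  \<comment> \<open>The weight of an edge is at least \<open>c\<close>, the heights lie between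
    \<open>a0\<close> and 1, and hence the denominator \<open>q\<close> is at most
    \<open>W\<close>.\<close>
  define \<kappa> where "\<kappa> = min 1 (c * a0 / W)"
  have kappa: "0 < \<kappa>" "\<kappa> \<le> 1" using c a0 W1 by (auto simp: \<kappa>_def)
  show thesis
  proof (rule that[of "1 - \<kappa> ^ CARD('n)"])
    show "0 \<le> 1 - \<kappa> ^ CARD('n)" "1 - \<kappa> ^ CARD('n) < 1"
      using kappa by (auto simp: power_le_one)
    fix Y :: "nat \<Rightarrow> 'n \<Rightarrow> real^'d" and e a R m i j
    assume a: "a0 \<le> a" and e: "norm e = 1" and Y: "\<And>t i. norm (Y t i) = 1" "\<And>t i. a \<le> Y t i \<bullet> e"
      and step: "\<And>t i. Y (Suc t) i = sphere_proj (\<Sum>j\<in>UNIV. ?w i j *\<^sub>R Y t j)"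
      and R: "\<And>i j. norm (Y 0 i /\<^sub>R (Y 0 i \<bullet> e) - Y 0 j /\<^sub>R (Y 0 j \<bullet> e)) \<le> R"
    define b where "b t i = Y t i \<bullet> e" for t i
    define U where "U t i = (\<Sum>j\<in>UNIV. ?w i j *\<^sub>R Y t j)" for t i
    define q where "q t i = (\<Sum>j\<in>UNIV. ?w i j * b t j)" for t i
    define p where "p t i j = ?w i j * b t j / q t i" for t i j
    define z where "z t i = Y t i /\<^sub>R b t i" for t i
    have b: "0 < b t i" "a \<le> b t i" "b t i \<le> 1" for t i
      using a a0 Y[of t i] e norm_cauchy_schwarz[of "Y t i" e] by (auto simp: b_def)
    have Ue: "U t i \<bullet> e = q t i" for t i
      by (simp add: U_def q_def b_def inner_sum_left)
    have q: "0 < q t i" for t i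
      using convex_cone_step(1)[of \<eta> a "Y t" e i, OF eta _ Y] a a0 Ue[of t i] by (simp add: U_def)
    have qW: "q t i \<le> W" for t i
    proof -
      have "q t i \<le> (\<Sum>j\<in>UNIV. ?w i j * 1)"
        unfolding q_def by (intro sum_mono mult_left_mono b w)
      then show ?thesis using W[of i] by simp
    qed
    have z_step: "z (Suc t) i = (\<Sum>j\<in>UNIV. p t i j *\<^sub>R z t j)" for t i
    proof -
      have "U t i \<noteq> 0" using q[of t i] Ue[of t i] by auto
      then have "z (Suc t) i = U t i /\<^sub>R q t i"
        by (simp add: z_def b_def step U_def[symmetric] sphere_proj_def Ue)
      also have "\<dots> = (\<Sum>j\<in>UNIV. p t i j *\<^sub>R z t j)"
        unfolding U_def scaleR_sum_right
      proof (intro sum.cong refl)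
        fix j
        show "(?w i j *\<^sub>R Y t j) /\<^sub>R q t i = p t i j *\<^sub>R z t j"
          using b(1)[of t j] by (simp add: p_def z_def divide_inverse mult.commute)
      qed
      finally show ?thesis .
    qed
    have "norm (z (CARD('n) * m) i - z (CARD('n) * m) j) \<le> (1 - \<kappa> ^ CARD('n)) ^ m * R"
    proof (rule averaging_diameter[where p = p and \<eta> = \<eta>])
      show "0 \<le> p t i j" for t i j
        using b(1)[of t j] q[of t i] w[of i j] by (simp add: p_def)
      show "(\<Sum>j\<in>UNIV. p t i j) = 1" for t i
        using q[of t i] by (simp add: p_def sum_divide_distrib[symmetric] q_def)
      show "\<kappa> \<le> p t i j" if "0 < \<eta> i j" for t i j
      proof -
        have "c \<le> ?w i j" using c_le[OF that] by (auto simp: lazy_weight_def)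
        then have "c * a0 \<le> ?w i j * b t j"
          using b(2)[of t j] a a0 c w by (intro mult_mono) auto
        then have "c * a0 / W \<le> p t i j"
          unfolding p_def using q qW b(1)[of t j] w[of i j] by (intro frac_le) auto
        then show ?thesis by (simp add: \<kappa>_def)
      qed
    qed (use kappa z_step R irred in \<open>auto simp: z_def b_def\<close>)
    \<comment> \<open>Return to the sphere: \<open>Y\<close> is the radial projection of
      \<open>z\<close>, and \<open>z\<close> has norm at least 1, where this projection does not
      increase distances.\<close>
    moreover have "Y t i = sphere_proj (z t i)" for t i
      using b(1)[of t i] Y(1)[of t i] by (simp add: z_def sphere_proj_scaleR_pos) (simp add: sphere_proj_def)
    moreover have "1 \<le> norm (z t i)" for t i
      using b[of t i] Y(1)[of t i] by (simp add: z_def one_le_inverse)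
    ultimately show "norm (Y (CARD('n) * m) i - Y (CARD('n) * m) j) \<le> (1 - \<kappa> ^ CARD('n)) ^ m * R"
      by (simp add: order_trans[OF sphere_proj_dist_le])
  qed
qed

subsection \<open>Trajectories with a constant sign pattern\<close>

text \<open>Two agents agree on \<xi> exactly when \<sigma> j = \<sigma> i, so attraction or
  repulsion is the factor \<sigma> i * \<sigma> j. The common sign \<open>s\<close> drops out, which
  is why a global flip is harmless.\<close>

lemma party_unnorm_aligned:
  assumes sgn: "\<And>j. sgn (X $ j \<bullet> \<xi>) = \<sigma> j * s" and s: "s \<noteq> 0"
    and \<sigma>: "\<And>j. \<sigma> j \<in> {-1, 1}"
  shows "party_unnorm \<eta> X \<xi> i = \<sigma> i *\<^sub>R (\<Sum>j\<in>UNIV. lazy_weight \<eta> i j *\<^sub>R (\<sigma> j *\<^sub>R X $ j))"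
proof -
  have eq: "sgn (X $ j \<bullet> \<xi>) = sgn (X $ i \<bullet> \<xi>) \<longleftrightarrow> \<sigma> j = \<sigma> i" for j
    using s by (simp add: sgn)
  have \<sigma>2: "\<sigma> j * \<sigma> j = 1" for j using \<sigma>[of j] by auto
  have "party_unnorm \<eta> X \<xi> i = X $ i + ((\<Sum>j\<in>{j. \<sigma> j = \<sigma> i}. \<eta> i j *\<^sub>R X $ j) + (\<Sum>j\<in>{j. \<not> \<sigma> j = \<sigma> i}. - \<eta> i j *\<^sub>R X $ j))"
    by (simp add: party_unnorm_def eq sum_negf)
  also have "\<dots> = X $ i + (\<Sum>j\<in>UNIV. if \<sigma> j = \<sigma> i then \<eta> i j *\<^sub>R X $ j else - \<eta> i j *\<^sub>R X $ j)"
    by (subst sum.If_cases) (auto simp: Collect_neg_eq)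
  also have "(\<Sum>j\<in>UNIV. if \<sigma> j = \<sigma> i then \<eta> i j *\<^sub>R X $ j else - \<eta> i j *\<^sub>R X $ j)
     = \<sigma> i *\<^sub>R (\<Sum>j\<in>UNIV. \<eta> i j *\<^sub>R (\<sigma> j *\<^sub>R X $ j))"
    unfolding scaleR_sum_right
  proof (intro sum.cong refl)
    fix j show "(if \<sigma> j = \<sigma> i then \<eta> i j *\<^sub>R X $ j else - \<eta> i j *\<^sub>R X $ j) = \<sigma> i *\<^sub>R \<eta> i j *\<^sub>R \<sigma> j *\<^sub>R X $ j"
      using \<sigma>[of i] \<sigma>[of j] by auto
  qed
  also have "X $ i = \<sigma> i *\<^sub>R (\<Sum>j\<in>UNIV. (if i = j then 1 else 0) *\<^sub>R (\<sigma> j *\<^sub>R X $ j))"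
  proof -
    have "(\<Sum>j\<in>UNIV. (if i = j then 1 else 0) *\<^sub>R (\<sigma> j *\<^sub>R X $ j)) = (\<Sum>j\<in>UNIV. if i = j then \<sigma> j *\<^sub>R X $ j else 0)"
      by (intro sum.cong) auto
    then show ?thesis by (simp add: \<sigma>2)
  qed
  finally show ?thesis
    by (simp add: lazy_weight_def scaleR_add_left sum.distrib scaleR_add_right distrib_right)
qed

text \<open>The hypothesis on \<open>G\<close> says that no admissible \<xi> separates the spherical
  cap of height \<open>a\<close> from \<open>e\<close>. While the flipped opinions lie in the cap,
  the update is an average, and the average stays in the cap.\<close>

lemma party_traj_in_cone:
  fixes X :: "real^'d^'n::finite"
  assumes eta: "\<And>i j. 0 \<le> \<eta> i j" and a: "0 < a"
    and G: "\<And>\<xi> y. \<lbrakk>\<xi> \<in> G; norm y = 1; a \<le> y \<bullet> e\<rbrakk> \<Longrightarrow> e \<bullet> \<xi> \<noteq> 0 \<and> sgn (y \<bullet> \<xi>) = sgn (e \<bullet> \<xi>)"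
    and \<sigma>: "\<And>j. \<sigma> j \<in> {-1, 1}"
    and X: "\<And>j. norm (X $ j) = 1" "\<And>j. a \<le> (\<sigma> j *\<^sub>R X $ j) \<bullet> e"
    and xs: "\<And>s. xs s \<in> G"
  defines "Y \<equiv> \<lambda>t i. \<sigma> i *\<^sub>R party_traj \<eta> X xs t $ i"
  shows "norm (Y t i) = 1" "a \<le> Y t i \<bullet> e"
    "Y (Suc t) i = sphere_proj (\<Sum>j\<in>UNIV. lazy_weight \<eta> i j *\<^sub>R Y t j)"
proof -
  have \<sigma>2: "\<sigma> j * \<sigma> j = 1" and abs: "\<bar>\<sigma> j\<bar> = 1" for j using \<sigma>[of j] by auto
  have step: "Y (Suc t) i = sphere_proj (\<Sum>j\<in>UNIV. lazy_weight \<eta> i j *\<^sub>R Y t j)"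
    if inv: "\<And>j. norm (Y t j) = 1" "\<And>j. a \<le> Y t j \<bullet> e" for t i
  proof -
    let ?Z = "party_traj \<eta> X xs t"
    have "sgn (?Z $ j \<bullet> xs t) = \<sigma> j * sgn (e \<bullet> xs t)" for j
    proof -
      have "?Z $ j = \<sigma> j *\<^sub>R Y t j" by (simp add: Y_def \<sigma>2)
      then have "sgn (?Z $ j \<bullet> xs t) = sgn (\<sigma> j) * sgn (Y t j \<bullet> xs t)" by (simp add: sgn_mult)
      also have "sgn (Y t j \<bullet> xs t) = sgn (e \<bullet> xs t)" using G[OF xs[of t] inv[of j]] by simp
      finally show ?thesis using \<sigma>[of j] by auto
    qed
    moreover have "sgn (e \<bullet> xs t) \<noteq> 0" using G[OF xs[of t] inv] by (simp add: sgn_zero_iff)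
    ultimately have "party_unnorm \<eta> ?Z (xs t) i = \<sigma> i *\<^sub>R (\<Sum>j\<in>UNIV. lazy_weight \<eta> i j *\<^sub>R Y t j)"
      unfolding Y_def by (intro party_unnorm_aligned \<sigma>)
    moreover have "Y (Suc t) i = \<sigma> i *\<^sub>R sphere_proj (party_unnorm \<eta> ?Z (xs t) i)"
      by (simp add: Y_def party_step_def)
    ultimately show ?thesis
      by (simp add: sphere_proj_scaleR_sign[OF \<sigma>] \<sigma>2)
  qed
  have inv: "\<forall>i. norm (Y t i) = 1 \<and> a \<le> Y t i \<bullet> e" for t
  proof (induction t)
    case 0
    then show ?case using X abs by (simp add: Y_def)
  next
    case (Suc t)
    then show ?case
      using step[of t] convex_cone_step(2,3)[of \<eta> a "Y t" e, OF eta a] by auto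
  qed
  show "norm (Y t i) = 1" "a \<le> Y t i \<bullet> e" using inv by auto
  show "Y (Suc t) i = sphere_proj (\<Sum>j\<in>UNIV. lazy_weight \<eta> i j *\<^sub>R Y t j)"
    using inv by (intro step) auto
qed

section \<open>Distance to the polarized set\<close>

lemma polarized_set_nonempty: "(polarized_set :: (real^'d^'n::finite) set) \<noteq> {}"
proof -
  fix k :: 'd
  have "(\<chi> i. 1 *\<^sub>R axis k 1) \<in> (polarized_set :: (real^'d^'n) set)"
    unfolding polarized_set_def
    by (intro CollectI exI[of _ "axis k 1"] exI[of _ "\<lambda>_. 1"]) simp
  then show ?thesis by blast
qed

text \<open>A finite union over sign vectors of continuous images of the sphere. Closedness is used
  later to pick a nearest polarized configuration.\<close>

lemma compact_polarized_set: "compact (polarized_set :: (real^'d^'n::finite) set)"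
proof -
  define S where "S = (PiE UNIV (\<lambda>_. {-1, 1}) :: ('n \<Rightarrow> real) set)"
  have S: "\<sigma> \<in> S \<longleftrightarrow> (\<forall>i. \<sigma> i \<in> {-1, 1})" for \<sigma>
    by (auto simp: S_def PiE_UNIV_domain)
  have eq: "polarized_set = (\<Union>\<sigma>\<in>S. (\<lambda>x::real^'d. (\<chi> i. \<sigma> i *\<^sub>R x)) ` sphere 0 1)"
    unfolding polarized_set_def using S by blast
  have "compact ((\<lambda>x::real^'d. (\<chi> i. \<sigma> i *\<^sub>R x)) ` sphere 0 1)" for \<sigma> :: "'n \<Rightarrow> real"
    by (intro compact_continuous_image continuous_on_vec_lambda continuous_intros) auto
  moreover have "finite S" by (simp add: S_def finite_PiE)
  ultimately show ?thesis unfolding eq by (intro compact_UN)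
qed

text \<open>An arbitrary agent \<open>k\<close> serves as reference: its flipped opinion, spread
  with the signs \<sigma>, is a polarized configuration. Bounding the Euclidean norm by the sum of
  the block norms costs the factor n.\<close>

lemma infdist_polarized_le:
  fixes X :: "real^'d^'n::finite" and R :: real
  assumes \<sigma>: "\<And>j. \<sigma> j \<in> {-1, 1}" and X: "\<And>j. norm (X $ j) = 1"
    and R: "\<And>i j. norm (\<sigma> i *\<^sub>R X $ i - \<sigma> j *\<^sub>R X $ j) \<le> R"
  shows "infdist X polarized_set \<le> CARD('n) * R"
proof -
  fix k :: 'n
  define y :: "real^'d^'n" where "y = (\<chi> i. \<sigma> i *\<^sub>R (\<sigma> k *\<^sub>R X $ k))"
  have abs: "\<bar>\<sigma> j\<bar> = 1" "\<sigma> j * \<sigma> j = 1" for j using \<sigma>[of j] by auto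
  have "y \<in> polarized_set"
    unfolding polarized_set_def y_def using \<sigma> X abs
    by (intro CollectI exI[of _ "\<sigma> k *\<^sub>R X $ k"] exI[of _ \<sigma>]) auto
  then have "infdist X polarized_set \<le> dist X y" by (rule infdist_le)
  also have "\<dots> \<le> (\<Sum>i\<in>UNIV. norm ((X - y) $ i))"
    unfolding dist_norm norm_vec_def by (rule L2_set_le_sum) auto
  also have "\<dots> \<le> (\<Sum>i\<in>(UNIV::'n set). R)"
  proof (rule sum_mono)
    fix i
    have "(X - y) $ i = \<sigma> i *\<^sub>R (\<sigma> i *\<^sub>R X $ i - \<sigma> k *\<^sub>R X $ k)"
      by (simp add: y_def scaleR_diff_right abs)
    then show "norm ((X - y) $ i) \<le> R" using R[of i k] abs by simp
  qed
  finally show ?thesis by simp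
qed

text \<open>The set \<open>G\<close> of admissible noise stays abstract so that both regimes can use
  this statement: \<open>G\<close> is the complement of a band near the polarized set and a small
  ball far from it.\<close>

lemma aligned_traj_contraction:
  fixes \<eta> :: "'n::finite \<Rightarrow> 'n \<Rightarrow> real"
  assumes eta: "\<And>i j. 0 \<le> \<eta> i j"
    and irred: "\<And>i j. matpow (adj_matrix \<eta>) CARD('n) $ i $ j > 0"
    and a0: "0 < a0"
  obtains \<theta> where "0 \<le> \<theta>" "\<theta> < 1"
    "\<And>(X :: real^'d^'n) e a R m G \<sigma> xs.
       \<lbrakk>a0 \<le> a; norm e = 1;
        \<And>\<xi> y. \<lbrakk>\<xi> \<in> G; norm y = 1; a \<le> y \<bullet> e\<rbrakk> \<Longrightarrow> e \<bullet> \<xi> \<noteq> 0 \<and> sgn (y \<bullet> \<xi>) = sgn (e \<bullet> \<xi>);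
        \<And>j. \<sigma> j \<in> {-1, 1}; \<And>j. norm (X $ j) = 1; \<And>j. a \<le> (\<sigma> j *\<^sub>R X $ j) \<bullet> e;
        \<And>i j. norm ((\<sigma> i *\<^sub>R X $ i) /\<^sub>R ((\<sigma> i *\<^sub>R X $ i) \<bullet> e) - (\<sigma> j *\<^sub>R X $ j) /\<^sub>R ((\<sigma> j *\<^sub>R X $ j) \<bullet> e)) \<le> R;
        \<And>s. xs s \<in> G\<rbrakk>
       \<Longrightarrow> (\<forall>j. norm (party_traj \<eta> X xs (CARD('n) * m) $ j) = 1) \<and>
           infdist (party_traj \<eta> X xs (CARD('n) * m)) polarized_set \<le> real CARD('n) * (\<theta> ^ m * R)"
proof -
  obtain \<theta> where \<theta>: "0 \<le> \<theta>" "\<theta> < 1"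
    and contr: "\<And>(Y :: nat \<Rightarrow> 'n \<Rightarrow> real^'d) e a R m i j.
       \<lbrakk>a0 \<le> a; norm e = 1; \<And>t i. norm (Y t i) = 1; \<And>t i. a \<le> Y t i \<bullet> e;
        \<And>t i. Y (Suc t) i = sphere_proj (\<Sum>j\<in>UNIV. lazy_weight \<eta> i j *\<^sub>R Y t j);
        \<And>i j. norm (Y 0 i /\<^sub>R (Y 0 i \<bullet> e) - Y 0 j /\<^sub>R (Y 0 j \<bullet> e)) \<le> R\<rbrakk>
       \<Longrightarrow> norm (Y (CARD('n) * m) i - Y (CARD('n) * m) j) \<le> \<theta> ^ m * R"
    using gauge_contraction[where 'd = 'd, OF eta irred a0] by blast
  show thesis
  proof (rule that[OF \<theta>])
    fix X :: "real^'d^'n" and e a R m G \<sigma> and xs :: "nat \<Rightarrow> real^'d"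
    assume a: "a0 \<le> a" and e: "norm e = 1"
      and G: "\<And>\<xi> y. \<lbrakk>\<xi> \<in> G; norm y = 1; a \<le> y \<bullet> e\<rbrakk> \<Longrightarrow> e \<bullet> \<xi> \<noteq> 0 \<and> sgn (y \<bullet> \<xi>) = sgn (e \<bullet> \<xi>)"
      and \<sigma>: "\<And>j. \<sigma> j \<in> {-1, 1}" and X: "\<And>j. norm (X $ j) = 1" "\<And>j. a \<le> (\<sigma> j *\<^sub>R X $ j) \<bullet> e"
      and R: "\<And>i j. norm ((\<sigma> i *\<^sub>R X $ i) /\<^sub>R ((\<sigma> i *\<^sub>R X $ i) \<bullet> e) - (\<sigma> j *\<^sub>R X $ j) /\<^sub>R ((\<sigma> j *\<^sub>R X $ j) \<bullet> e)) \<le> R"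
      and xs: "\<And>s. xs s \<in> G"
    define Y where "Y t i = \<sigma> i *\<^sub>R party_traj \<eta> X xs t $ i" for t i
    have a_pos: "0 < a" using a a0 by simp
    have abs: "\<bar>\<sigma> j\<bar> = 1" for j using \<sigma>[of j] by auto
    note in_cone = party_traj_in_cone[where \<eta> = \<eta> and a = a and G = G and e = e and \<sigma> = \<sigma> and X = X and xs = xs,
        OF eta a_pos G \<sigma> X xs]
    have cone: "norm (Y t i) = 1" "a \<le> Y t i \<bullet> e"
        "Y (Suc t) i = sphere_proj (\<Sum>j\<in>UNIV. lazy_weight \<eta> i j *\<^sub>R Y t j)" for t i
      unfolding Y_def by (rule in_cone; assumption)+
    have unit: "norm (party_traj \<eta> X xs t $ j) = 1" for t j
    proof -
      have "norm (Y t j) = 1" by (rule cone(1))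
      then show ?thesis by (simp add: Y_def abs)
    qed
    have "norm (Y (CARD('n) * m) i - Y (CARD('n) * m) j) \<le> \<theta> ^ m * R" for i j
      by (rule contr[where Y = Y and e = e, OF a e cone]) (use R in \<open>simp add: Y_def\<close>)
    then show "(\<forall>j. norm (party_traj \<eta> X xs (CARD('n) * m) $ j) = 1) \<and>
           infdist (party_traj \<eta> X xs (CARD('n) * m)) polarized_set \<le> real CARD('n) * (\<theta> ^ m * R)"
      unfolding Y_def using infdist_polarized_le[where \<sigma> = \<sigma>, OF \<sigma> unit] unit by blast
  qed
qed

section \<open>Contraction near the polarized set and far from it\<close>

lemma power_eventually_small:
  fixes \<theta> :: real
  assumes "0 \<le> \<theta>" "\<theta> < 1" "0 < \<epsilon>"
  obtains N where "\<And>m. N \<le> m \<Longrightarrow> c * \<theta> ^ m \<le> \<epsilon>"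
proof -
  have "(\<lambda>m. c * \<theta> ^ m) \<longlonglongrightarrow> c * 0"
    using assms by (intro tendsto_intros LIMSEQ_power_zero) auto
  then have "\<forall>\<^sub>F m in sequentially. c * \<theta> ^ m < \<epsilon>"
    using assms(3) by (intro order_tendstoD(2)) auto
  then show ?thesis using that by (auto simp: eventually_sequentially intro: less_imp_le)
qed

text \<open>The axis \<open>e\<close> comes from a nearest polarized configuration at distance r.
  All flipped opinions are within r of \<open>e\<close>, so a noise with \<bar>\<xi> \<bullet>
  e\<bar> > r cannot separate them. The initial spread is linear in r, hence \<open>m\<close> can be
  chosen before \<open>X\<close>.\<close>

lemma contraction_near_polarized:
  fixes \<eta> :: "'n::finite \<Rightarrow> 'n \<Rightarrow> real"
  assumes eta: "\<And>i j. 0 \<le> \<eta> i j"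
    and irred: "\<And>i j. matpow (adj_matrix \<eta>) CARD('n) $ i $ j > 0"
  obtains m where "0 < m"
    "\<And>X :: real^'d^'n. \<lbrakk>\<And>j. norm (X $ j) = 1; infdist X polarized_set \<le> 1\<rbrakk>
      \<Longrightarrow> \<exists>e. norm e = 1 \<and> (\<forall>xs. (\<forall>s. norm (xs s) = 1 \<and> infdist X polarized_set < \<bar>xs s \<bullet> e\<bar>) \<longrightarrow>
             (\<forall>j. norm (party_traj \<eta> X xs (CARD('n) * m) $ j) = 1) \<and>
             infdist (party_traj \<eta> X xs (CARD('n) * m)) polarized_set \<le> infdist X polarized_set / 4)"
proof -
  obtain \<theta> where \<theta>: "0 \<le> \<theta>" "\<theta> < 1"
    and contr: "\<And>(X :: real^'d^'n) e a R m G \<sigma> xs.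
       \<lbrakk>1 / 2 \<le> a; norm e = 1;
        \<And>\<xi> y. \<lbrakk>\<xi> \<in> G; norm y = 1; a \<le> y \<bullet> e\<rbrakk> \<Longrightarrow> e \<bullet> \<xi> \<noteq> 0 \<and> sgn (y \<bullet> \<xi>) = sgn (e \<bullet> \<xi>);
        \<And>j. \<sigma> j \<in> {-1, 1}; \<And>j. norm (X $ j) = 1; \<And>j. a \<le> (\<sigma> j *\<^sub>R X $ j) \<bullet> e;
        \<And>i j. norm ((\<sigma> i *\<^sub>R X $ i) /\<^sub>R ((\<sigma> i *\<^sub>R X $ i) \<bullet> e) - (\<sigma> j *\<^sub>R X $ j) /\<^sub>R ((\<sigma> j *\<^sub>R X $ j) \<bullet> e)) \<le> R;
        \<And>s. xs s \<in> G\<rbrakk>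
       \<Longrightarrow> (\<forall>j. norm (party_traj \<eta> X xs (CARD('n) * m) $ j) = 1) \<and>
           infdist (party_traj \<eta> X xs (CARD('n) * m)) polarized_set \<le> real CARD('n) * (\<theta> ^ m * R)"
    by (rule aligned_traj_contraction[where 'd = 'd, of \<eta> "1 / 2"]) (use eta irred in auto)
  \<comment> \<open>The rescaled vectors have spread at most 6 r, twice the bound 3 r obtained
    below. The target 1/4 leaves room for the probability of a bad noise in the drift
    estimate.\<close>
  obtain N where N: "\<And>m. N \<le> m \<Longrightarrow> real CARD('n) * 6 * \<theta> ^ m \<le> 1 / 4"
    using power_eventually_small[OF \<theta>, of "1 / 4" "real CARD('n) * 6"] by auto
  define m where "m = Suc N"
  have m: "real CARD('n) * 6 * \<theta> ^ m \<le> 1 / 4" by (rule N) (simp add: m_def)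
  show thesis
  proof (rule that[of m])
    fix X :: "real^'d^'n" assume X: "\<And>j. norm (X $ j) = 1" and le1: "infdist X polarized_set \<le> 1"
    define r where "r = infdist X polarized_set"
    have r: "0 \<le> r" "r \<le> 1" using le1 by (auto simp: r_def infdist_nonneg)
    have r2: "r\<^sup>2 \<le> r" using r by (simp add: power2_eq_square mult_left_le)
    obtain y where y: "y \<in> polarized_set" "r = dist X y"
      unfolding r_def using infdist_attains_inf[OF compact_imp_closed[OF compact_polarized_set] polarized_set_nonempty] by blast
    then obtain e \<sigma> where e: "norm e = 1" and \<sigma>: "\<And>j. \<sigma> j \<in> {-1, 1}" and y_eq: "y = (\<chi> i. \<sigma> i *\<^sub>R e)"
      by (auto simp: polarized_set_def)
    have abs: "\<bar>\<sigma> j\<bar> = 1" "\<sigma> j * \<sigma> j = 1" for j using \<sigma>[of j] by auto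
    define Y where "Y j = \<sigma> j *\<^sub>R X $ j" for j
    have Y1: "norm (Y j) = 1" for j by (simp add: Y_def abs X)
    have near: "norm (Y j - e) \<le> r" for j
    proof -
      have "Y j - e = \<sigma> j *\<^sub>R (X - y) $ j" by (simp add: Y_def y_eq scaleR_diff_right abs)
      then have "norm (Y j - e) = norm ((X - y) $ j)" by (simp add: abs)
      also have "\<dots> \<le> r" unfolding y(2) dist_norm by (rule Finite_Cartesian_Product.norm_nth_le)
      finally show ?thesis .
    qed
    have polar: "(norm (u - e))\<^sup>2 = 2 - 2 * (u \<bullet> e)" if "norm u = 1" for u
    proof -
      have "(norm (u - e))\<^sup>2 = (norm u)\<^sup>2 + (norm e)\<^sup>2 - 2 * (u \<bullet> e)"
        unfolding power2_norm_eq_inner by (simp add: algebra_simps inner_commute)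
      then show ?thesis using that e by simp
    qed
    \<comment> \<open>On the sphere, height at least this \<open>a\<close> over \<open>e\<close> is
      the same as distance at most r from \<open>e\<close>, by \<open>polar\<close>.\<close>
    define a where "a = 1 - r\<^sup>2 / 2"
    have Ye: "a \<le> Y j \<bullet> e" for j
      using polar[OF Y1, of j] power_mono[OF near[of j], of 2] by (simp add: a_def)
    have a: "1 / 2 \<le> a" using r2 r by (simp add: a_def)
    \<comment> \<open>The rescaled vector differs from \<open>e\<close> by the scaled displacement,
      at most 2 r, and by the height defect, at most r^2 \<le> r.\<close>
    have gauge: "norm (Y j /\<^sub>R (Y j \<bullet> e) - e) \<le> 3 * r" for j
    proof -
      let ?b = "Y j \<bullet> e"
      have b: "1 / 2 \<le> ?b" "?b \<le> 1" "1 - ?b \<le> r\<^sup>2 / 2"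
        using Ye[of j] a norm_cauchy_schwarz[of "Y j" e] Y1 e by (auto simp: a_def)
      have inv: "inverse ?b \<le> 2" "0 < inverse ?b" using b le_imp_inverse_le[of "1 / 2" ?b] by auto
      have "Y j /\<^sub>R ?b - e = inverse ?b *\<^sub>R (Y j - e) + (inverse ?b * (1 - ?b)) *\<^sub>R e"
        using b by (simp add: algebra_simps)
      then have "norm (Y j /\<^sub>R ?b - e) \<le> norm (inverse ?b *\<^sub>R (Y j - e)) + norm ((inverse ?b * (1 - ?b)) *\<^sub>R e)"
        by (metis norm_triangle_ineq)
      also have "\<dots> = inverse ?b * norm (Y j - e) + inverse ?b * (1 - ?b)"
        using inv b e by (simp add: abs_mult)
      also have "\<dots> \<le> 2 * r + 2 * (r\<^sup>2 / 2)"
        using inv b near[of j] by (intro add_mono mult_mono) auto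
      also have "\<dots> \<le> 3 * r" using r2 by simp
      finally show ?thesis .
    qed
    define G where "G = {\<xi>. norm \<xi> = 1 \<and> r < \<bar>\<xi> \<bullet> e\<bar>}"
    have G: "e \<bullet> \<xi> \<noteq> 0 \<and> sgn (u \<bullet> \<xi>) = sgn (e \<bullet> \<xi>)" if "\<xi> \<in> G" "norm u = 1" "a \<le> u \<bullet> e" for \<xi> u
    proof -
      have "(norm (u - e))\<^sup>2 \<le> r\<^sup>2" using polar[OF that(2)] that(3) by (simp add: a_def)
      then have "norm (u - e) \<le> r" using r by (simp add: power2_le_iff_abs_le)
      moreover have "\<bar>(u - e) \<bullet> \<xi>\<bar> \<le> norm (u - e) * norm \<xi>" by (rule Cauchy_Schwarz_ineq2)
      ultimately have "\<bar>u \<bullet> \<xi> - e \<bullet> \<xi>\<bar> \<le> r"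
        using that(1) by (simp add: G_def inner_diff_left)
      moreover have "r < \<bar>e \<bullet> \<xi>\<bar>" using that(1) by (simp add: G_def inner_commute)
      ultimately have "\<bar>u \<bullet> \<xi> - e \<bullet> \<xi>\<bar> < \<bar>e \<bullet> \<xi>\<bar>" by simp
      then show ?thesis by (auto simp: sgn_if)
    qed
    have "(\<forall>j. norm (party_traj \<eta> X xs (CARD('n) * m) $ j) = 1) \<and>
          infdist (party_traj \<eta> X xs (CARD('n) * m)) polarized_set \<le> r / 4"
      if xs: "\<And>s. xs s \<in> G" for xs
    proof -
      have "(\<forall>j. norm (party_traj \<eta> X xs (CARD('n) * m) $ j) = 1) \<and>
           infdist (party_traj \<eta> X xs (CARD('n) * m)) polarized_set \<le> real CARD('n) * (\<theta> ^ m * (6 * r))"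
      proof (rule contr[OF a e G \<sigma> X Ye[unfolded Y_def] _ xs], unfold Y_def[symmetric])
        fix i j
        have "norm (Y i /\<^sub>R (Y i \<bullet> e) - Y j /\<^sub>R (Y j \<bullet> e))
            \<le> norm (Y i /\<^sub>R (Y i \<bullet> e) - e) + norm (Y j /\<^sub>R (Y j \<bullet> e) - e)"
          using dist_triangle2[of "Y i /\<^sub>R (Y i \<bullet> e)" "Y j /\<^sub>R (Y j \<bullet> e)" e] by (simp add: dist_norm)
        then show "norm (Y i /\<^sub>R (Y i \<bullet> e) - Y j /\<^sub>R (Y j \<bullet> e)) \<le> 6 * r"
          using gauge[of i] gauge[of j] by simp
      qed
      moreover have "real CARD('n) * (\<theta> ^ m * (6 * r)) \<le> r / 4"
        using mult_right_mono[OF m r(1)] by (simp add: mult_ac)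
      ultimately show ?thesis by simp
    qed
    then show "\<exists>e. norm e = 1 \<and> (\<forall>xs. (\<forall>s. norm (xs s) = 1 \<and> infdist X polarized_set < \<bar>xs s \<bullet> e\<bar>) \<longrightarrow>
             (\<forall>j. norm (party_traj \<eta> X xs (CARD('n) * m) $ j) = 1) \<and>
             infdist (party_traj \<eta> X xs (CARD('n) * m)) polarized_set \<le> infdist X polarized_set / 4)"
      using e unfolding G_def r_def by blast
  qed (simp add: m_def)
qed

text \<open>Nothing is assumed about the distance to the polarized set: the signs are read off from
  \<open>e\<close>, and heights at least \<delta> bound the rescaled vectors by 1/\<delta>, hence
  their spread by 2/\<delta>. The claim covers all \<open>m \<ge> N\<close> because the block length
  must later also be a multiple of that of the near regime.\<close>

lemma contraction_far:
  fixes \<eta> :: "'n::finite \<Rightarrow> 'n \<Rightarrow> real"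
  assumes eta: "\<And>i j. 0 \<le> \<eta> i j"
    and irred: "\<And>i j. matpow (adj_matrix \<eta>) CARD('n) $ i $ j > 0"
    and \<delta>: "0 < \<delta>" "\<delta> \<le> 1" and \<epsilon>: "0 < \<epsilon>"
  obtains N where
    "\<And>(X :: real^'d^'n) e xs m. \<lbrakk>N \<le> m; \<And>j. norm (X $ j) = 1; norm e = 1; \<And>j. \<delta> \<le> \<bar>X $ j \<bullet> e\<bar>;
        \<And>s. xs s \<in> ball e (\<delta> / 2)\<rbrakk>
      \<Longrightarrow> (\<forall>j. norm (party_traj \<eta> X xs (CARD('n) * m) $ j) = 1) \<and>
          infdist (party_traj \<eta> X xs (CARD('n) * m)) polarized_set \<le> \<epsilon>"
proof -
  obtain \<theta> where \<theta>: "0 \<le> \<theta>" "\<theta> < 1"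
    and contr: "\<And>(X :: real^'d^'n) e a R m G \<sigma> xs.
       \<lbrakk>\<delta> \<le> a; norm e = 1;
        \<And>\<xi> y. \<lbrakk>\<xi> \<in> G; norm y = 1; a \<le> y \<bullet> e\<rbrakk> \<Longrightarrow> e \<bullet> \<xi> \<noteq> 0 \<and> sgn (y \<bullet> \<xi>) = sgn (e \<bullet> \<xi>);
        \<And>j. \<sigma> j \<in> {-1, 1}; \<And>j. norm (X $ j) = 1; \<And>j. a \<le> (\<sigma> j *\<^sub>R X $ j) \<bullet> e;
        \<And>i j. norm ((\<sigma> i *\<^sub>R X $ i) /\<^sub>R ((\<sigma> i *\<^sub>R X $ i) \<bullet> e) - (\<sigma> j *\<^sub>R X $ j) /\<^sub>R ((\<sigma> j *\<^sub>R X $ j) \<bullet> e)) \<le> R;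
        \<And>s. xs s \<in> G\<rbrakk>
       \<Longrightarrow> (\<forall>j. norm (party_traj \<eta> X xs (CARD('n) * m) $ j) = 1) \<and>
           infdist (party_traj \<eta> X xs (CARD('n) * m)) polarized_set \<le> real CARD('n) * (\<theta> ^ m * R)"
    by (rule aligned_traj_contraction[where 'd = 'd, of \<eta> \<delta>]) (use eta irred \<delta> in auto)
  obtain N where N: "\<And>m. N \<le> m \<Longrightarrow> real CARD('n) * (2 / \<delta>) * \<theta> ^ m \<le> \<epsilon>"
    using power_eventually_small[OF \<theta> \<epsilon>, of "real CARD('n) * (2 / \<delta>)"] by auto
  show thesis
  proof (rule that[of N])
    fix X :: "real^'d^'n" and e m and xs :: "nat \<Rightarrow> real^'d"
    assume m: "N \<le> m" and X: "\<And>j. norm (X $ j) = 1" and e: "norm e = 1"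
      and Xe: "\<And>j. \<delta> \<le> \<bar>X $ j \<bullet> e\<bar>" and xs: "\<And>s. xs s \<in> ball e (\<delta> / 2)"
    define \<sigma> where "\<sigma> j = sgn (X $ j \<bullet> e)" for j
    have "X $ j \<bullet> e \<noteq> 0" for j using Xe[of j] \<delta> by auto
    then have \<sigma>: "\<sigma> j \<in> {-1, 1}" for j by (auto simp: \<sigma>_def sgn_if)
    have Ye: "\<delta> \<le> (\<sigma> j *\<^sub>R X $ j) \<bullet> e" for j using Xe[of j] by (simp add: \<sigma>_def abs_sgn mult.commute)
    \<comment> \<open>Moving from \<open>e\<close> to \<xi> changes the inner product with a unit
      vector by less than \<delta>/2. This is applied to \<open>e\<close> itself as well, so all
      signs are positive.\<close>
    have pos: "0 < y \<bullet> \<xi>" if "\<xi> \<in> ball e (\<delta> / 2)" "norm y = 1" "\<delta> \<le> y \<bullet> e" for \<xi> y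
    proof -
      have "\<bar>y \<bullet> (\<xi> - e)\<bar> \<le> norm y * norm (\<xi> - e)" by (rule Cauchy_Schwarz_ineq2)
      also have "\<dots> < \<delta> / 2" using that by (simp add: dist_norm norm_minus_commute)
      finally have "\<bar>y \<bullet> \<xi> - y \<bullet> e\<bar> < \<delta> / 2" by (simp add: inner_diff_right)
      then show ?thesis using that(3) \<delta> by linarith
    qed
    have ee: "e \<bullet> e = 1" using e by (simp add: power2_norm_eq_inner[symmetric])
    have "(\<forall>j. norm (party_traj \<eta> X xs (CARD('n) * m) $ j) = 1) \<and>
          infdist (party_traj \<eta> X xs (CARD('n) * m)) polarized_set \<le> real CARD('n) * (\<theta> ^ m * (2 / \<delta>))"
    proof (rule contr[OF order_refl e _ \<sigma> X Ye _ xs])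
      fix \<xi> y assume "\<xi> \<in> ball e (\<delta> / 2)" "norm y = 1" "\<delta> \<le> y \<bullet> e"
      then show "e \<bullet> \<xi> \<noteq> 0 \<and> sgn (y \<bullet> \<xi>) = sgn (e \<bullet> \<xi>)"
        using pos[of \<xi> y] pos[of \<xi> e] e ee \<delta> by simp
    next
      fix i j
      have gauge: "norm (u /\<^sub>R (u \<bullet> e)) \<le> 1 / \<delta>" if "norm u = 1" "\<delta> \<le> u \<bullet> e" for u
        using that \<delta> by (simp add: divide_inverse)
      have "norm ((\<sigma> j *\<^sub>R X $ j) /\<^sub>R ((\<sigma> j *\<^sub>R X $ j) \<bullet> e)) \<le> 1 / \<delta>" for j
        by (rule gauge[OF _ Ye]) (use X[of j] \<sigma>[of j] in auto)
      from this[of i] this[of j]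
      show "norm ((\<sigma> i *\<^sub>R X $ i) /\<^sub>R ((\<sigma> i *\<^sub>R X $ i) \<bullet> e) - (\<sigma> j *\<^sub>R X $ j) /\<^sub>R ((\<sigma> j *\<^sub>R X $ j) \<bullet> e)) \<le> 2 / \<delta>"
        by (intro order_trans[OF norm_triangle_ineq4]) simp
    qed
    then show "(\<forall>j. norm (party_traj \<eta> X xs (CARD('n) * m) $ j) = 1) \<and>
          infdist (party_traj \<eta> X xs (CARD('n) * m)) polarized_set \<le> \<epsilon>"
      using N[OF m] by (simp add: mult_ac)
  qed
qed

subsection \<open>Slabs and caps of the sphere\<close>

lemma cball_slab_lmeasurable:
  fixes e :: "'a::euclidean_space"
  shows "{x \<in> cball 0 1. \<bar>x \<bullet> e\<bar> \<le> r} \<in> fmeasurable lborel"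
proof -
  have "closed {x \<in> cball 0 1. \<bar>x \<bullet> e\<bar> \<le> r}"
    unfolding mem_cball_0 by (intro closed_Collect_conj closed_Collect_le continuous_intros)
  then have "compact {x \<in> cball 0 1. \<bar>x \<bullet> e\<bar> \<le> r}"
    by (auto simp: compact_eq_bounded_closed intro: bounded_subset[OF bounded_cball[of 0 1]])
  then show ?thesis by (rule fmeasurable_compact)
qed

text \<open>About \<open>1 / (3 r)\<close> disjoint translates of the slab fit into the ball of radius 2. The
  rotation invariance of Lebesgue measure is only available for well-ordered index types.\<close>

lemma measure_cball_slab_le_pos:
  fixes e :: "'a::euclidean_space"
  assumes e: "norm e = 1" and r: "0 < r"
  shows "measure lborel {x \<in> cball 0 1. \<bar>x \<bullet> e\<bar> \<le> r} \<le> 6 * measure lborel (cball (0::'a) 2) * r"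
proof -
  define S where "S = {x \<in> cball 0 1. \<bar>x \<bullet> e\<bar> \<le> r}"
  define V where "V = measure lborel (cball (0::'a) 2)"
  have V: "0 \<le> V" by (simp add: V_def)
  have S: "S \<in> fmeasurable lborel" unfolding S_def by (rule cball_slab_lmeasurable)
  then have Sl: "S \<in> lmeasurable" by (simp add: fmeasurable_def)
  show ?thesis
  proof (cases "r \<le> 1 / 3")
    case False
    have "measure lborel S \<le> V"
      unfolding V_def using S by (intro measure_mono_fmeasurable fmeasurable_compact) (auto simp: S_def fmeasurableD)
    also have "\<dots> \<le> V * (6 * r)" using False V mult_left_mono[of 1 "6 * r" V] by simp
    finally show ?thesis by (simp add: S_def V_def mult_ac)
  next
    case True
    define N where "N = nat \<lfloor>1 / (3 * r)\<rfloor>"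
    have ge1: "1 \<le> 1 / (3 * r)" using True r by (simp add: field_simps)
    then have "1 \<le> \<lfloor>1 / (3 * r)\<rfloor>" by simp
    then have "int N = \<lfloor>1 / (3 * r)\<rfloor>" "1 \<le> N" unfolding N_def by linarith+
    then have "real N = of_int \<lfloor>1 / (3 * r)\<rfloor>" "1 \<le> real N" by (metis of_int_of_nat_eq, simp)
    \<comment> \<open>Since 1 / (3 r) \<ge> 1, rounding down loses at most a factor 2; this turns
      the spacing 3 r into the constant 6.\<close>
    then have N: "real N \<le> 1 / (3 * r)" "1 / (3 * r) \<le> 2 * real N"
      by linarith+
    define F where "F j = (+) ((3 * r * real j) *\<^sub>R e) ` S" for j
    have ee: "e \<bullet> e = 1" using e by (simp add: power2_norm_eq_inner[symmetric])
    have F: "F j \<in> lmeasurable" "measure lebesgue (F j) = measure lebesgue S" for j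
      unfolding F_def using Sl by (auto simp: measurable_translation measure_translation)
    have F_inner: "\<bar>y \<bullet> e - 3 * r * real j\<bar> \<le> r" if "y \<in> F j" for y j
      using that ee by (auto simp: F_def S_def inner_add_left)
    have disj: "disjnt (F i) (F j)" if ij: "i < j" for i j
    proof (rule ccontr)
      assume "\<not> disjnt (F i) (F j)"
      then obtain y where "y \<in> F i" "y \<in> F j" by (auto simp: disjnt_iff)
      then have "3 * r * real j - 3 * r * real i \<le> 2 * r"
        using F_inner[of y i] F_inner[of y j] by linarith
      moreover have "3 * r * (real i + 1) \<le> 3 * r * real j"
        using ij r by (intro mult_left_mono) auto
      ultimately show False using r by (simp add: algebra_simps)
    qed
    have "real N * measure lebesgue S = (\<Sum>j<N. measure lebesgue (F j))"
      by (simp add: F)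
    also have "\<dots> = measure lebesgue (\<Union>j<N. F j)"
    proof (rule measure_UNION'[symmetric])
      show "pairwise (\<lambda>i j. disjnt (F i) (F j)) {..<N}"
        using disj by (auto simp: pairwise_def disjnt_sym neq_iff)
    qed (use F in auto)
    also have "\<dots> \<le> measure lebesgue (cball (0::'a) 2)"
    proof (rule measure_mono_fmeasurable)
      show "(\<Union>j<N. F j) \<subseteq> cball 0 2"
      proof clarify
        fix y j assume j: "j < N" and "y \<in> F j"
        then obtain x where x: "y = (3 * r * real j) *\<^sub>R e + x" "norm x \<le> 1"
          by (auto simp: F_def S_def)
        have "3 * r * real j \<le> 3 * r * real N" using j r by (intro mult_left_mono) auto
        also have "\<dots> \<le> 1" using N(1) r by (simp add: field_simps)
        finally have "norm ((3 * r * real j) *\<^sub>R e) \<le> 1" using e r by simp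
        then show "y \<in> cball 0 2"
          using x norm_triangle_ineq[of "(3 * r * real j) *\<^sub>R e" x] by simp
      qed
      show "(\<Union>j<N. F j) \<in> sets lebesgue" using F by (intro sets.finite_UN) (auto simp: fmeasurableD)
    qed auto
    finally have "real N * measure lborel S \<le> V"
      using measure_completion[OF fmeasurableD[OF S]] by (simp add: V_def)
    then have "6 * r * (real N * measure lborel S) \<le> 6 * r * V"
      using r by (intro mult_left_mono) auto
    moreover have "1 \<le> 6 * r * real N" using N(2) r by (simp add: field_simps)
    then have "1 * measure lborel S \<le> 6 * r * real N * measure lborel S"
      by (intro mult_right_mono) auto
    ultimately show ?thesis by (simp add: S_def V_def mult_ac)
  qed
qed

text \<open>Includes r = 0, which occurs for configurations that are already polarized: a slab is
  contained in all slightly wider ones, and the bound is continuous in the width.\<close>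

lemma measure_cball_slab_le:
  fixes e :: "'a::euclidean_space"
  assumes e: "norm e = 1" and r: "0 \<le> r"
  shows "measure lborel {x \<in> cball 0 1. \<bar>x \<bullet> e\<bar> \<le> r} \<le> 6 * measure lborel (cball (0::'a) 2) * r"
proof (rule tendsto_lowerbound)
  let ?K = "6 * measure lborel (cball (0::'a) 2)"
  show "((\<lambda>s. ?K * s) \<longlongrightarrow> ?K * r) (at_right r)" by (intro tendsto_intros)
  show "\<forall>\<^sub>F s in at_right r. measure lborel {x \<in> cball 0 1. \<bar>x \<bullet> e\<bar> \<le> r} \<le> ?K * s"
  proof (rule eventually_at_rightI)
    fix s assume s: "s \<in> {r<..<r + 1}"
    have "measure lborel {x \<in> cball 0 1. \<bar>x \<bullet> e\<bar> \<le> r} \<le> measure lborel {x \<in> cball 0 1. \<bar>x \<bullet> e\<bar> \<le> s}"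
      using s cball_slab_lmeasurable[of e] by (intro measure_mono_fmeasurable) (auto simp: fmeasurableD)
    also have "\<dots> \<le> ?K * s" using s r by (intro measure_cball_slab_le_pos e) auto
    finally show "measure lborel {x \<in> cball 0 1. \<bar>x \<bullet> e\<bar> \<le> r} \<le> ?K * s" .
  qed simp
qed simp

lemma sphere_proj_measurable [measurable]: "sphere_proj \<in> borel_measurable borel"
  unfolding sphere_proj_def by measurable

text \<open>Written as a preimage under the radial projection, the cone over a Borel set is visibly
  Borel.\<close>

lemma cone_eq:
  fixes B :: "(real^'d) set"
  assumes "B \<subseteq> sphere 0 1"
  shows "{r *\<^sub>R x | r x. 0 < r \<and> r \<le> 1 \<and> x \<in> B} = {y \<in> cball 0 1. y \<noteq> 0 \<and> sphere_proj y \<in> B}"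
proof (intro equalityI subsetI)
  fix y assume "y \<in> {r *\<^sub>R x | r x. 0 < r \<and> r \<le> 1 \<and> x \<in> B}"
  then obtain r x where y: "y = r *\<^sub>R x" "0 < r" "r \<le> 1" "x \<in> B" by auto
  then have "norm x = 1" using assms by auto
  then show "y \<in> {y \<in> cball 0 1. y \<noteq> 0 \<and> sphere_proj y \<in> B}"
    using y by (auto simp: sphere_proj_def)
next
  fix y assume y: "y \<in> {y \<in> cball 0 1. y \<noteq> 0 \<and> sphere_proj y \<in> B}"
  then have "y = norm y *\<^sub>R sphere_proj y" by (simp add: sphere_proj_def)
  then show "y \<in> {r *\<^sub>R x | r x. 0 < r \<and> r \<le> 1 \<and> x \<in> B}"
    using y by (intro CollectI exI[of _ "norm y"] exI[of _ "sphere_proj y"]) auto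
qed

lemma cone_borel:
  fixes B :: "(real^'d) set"
  assumes "B \<subseteq> sphere 0 1" "B \<in> sets borel"
  shows "{r *\<^sub>R x | r x. 0 < r \<and> r \<le> 1 \<and> x \<in> B} \<in> sets borel"
proof -
  note [measurable] = assms(2)
  have "Measurable.pred borel (\<lambda>y::real^'d. norm y \<le> 1 \<and> y \<noteq> 0 \<and> sphere_proj y \<in> B)"
    by measurable
  then show ?thesis unfolding cone_eq[OF assms(1)] mem_cball_0 by (simp add: pred_def)
qed

lemma measure_cball_pos: "0 < measure lborel (cball (0::real^'d) r)" if "0 < r"
  using content_cball_pos[OF that, of "0::real^'d"] by simp

text \<open>Scaling by a factor at most 1 does not increase \<bar>x \<bullet> e\<bar>, so the cone
  over the band lies in the slab of the ball.\<close>

lemma sphere_unif_slab_le: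
  fixes e :: "real^'d"
  assumes e: "norm e = 1" and r: "0 \<le> r"
  shows "sphere_unif {x \<in> sphere 0 1. \<bar>x \<bullet> e\<bar> \<le> r}
           \<le> 6 * measure lborel (cball (0::real^'d) 2) / measure lborel (cball (0::real^'d) 1) * r"
proof -
  let ?B = "{x \<in> sphere 0 1. \<bar>x \<bullet> e\<bar> \<le> r}"
  have clB: "closed ?B"
    unfolding mem_sphere_0 by (intro closed_Collect_conj closed_Collect_le closed_Collect_eq continuous_intros)
  have "measure lborel {s *\<^sub>R x | s x. 0 < s \<and> s \<le> 1 \<and> x \<in> ?B}
         \<le> measure lborel {x \<in> cball 0 1. \<bar>x \<bullet> e\<bar> \<le> r}"
  proof (rule measure_mono_fmeasurable)
    show "{s *\<^sub>R x | s x. 0 < s \<and> s \<le> 1 \<and> x \<in> ?B} \<subseteq> {x \<in> cball 0 1. \<bar>x \<bullet> e\<bar> \<le> r}"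
    proof clarsimp
      fix s :: real and x :: "real^'d" assume "0 < s" "s \<le> 1" "\<bar>x \<bullet> e\<bar> \<le> r"
      then show "\<bar>s * (x \<bullet> e)\<bar> \<le> r"
        using mult_mono[of s 1 "\<bar>x \<bullet> e\<bar>" r] by (simp add: abs_mult)
    qed
    show "{s *\<^sub>R x | s x. 0 < s \<and> s \<le> 1 \<and> x \<in> ?B} \<in> sets lborel"
      using clB by (simp only: sets_lborel) (intro cone_borel borel_closed, auto)
  qed (rule cball_slab_lmeasurable)
  also have "\<dots> \<le> 6 * measure lborel (cball (0::real^'d) 2) * r" by (rule measure_cball_slab_le[OF e r])
  finally show ?thesis
    by (simp add: sphere_unif_def divide_right_mono)
qed

text \<open>The cone over the cap contains the ball of radius \<delta>/4 about the midpoint of 0 and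
  \<open>e\<close>, whose volume does not depend on \<open>e\<close>.\<close>

lemma sphere_unif_cap_ge:
  fixes e :: "real^'d"
  assumes e: "norm e = 1" and \<delta>: "0 < \<delta>" "\<delta> \<le> 1"
  shows "measure lborel (ball (0::real^'d) (\<delta> / 4)) / measure lborel (cball (0::real^'d) 1)
           \<le> sphere_unif (sphere 0 1 \<inter> ball e \<delta>)"
proof -
  let ?B = "sphere 0 1 \<inter> ball e \<delta>"
  have "measure lborel (ball (0::real^'d) (\<delta> / 4)) = measure lborel (ball (e /\<^sub>R 2) (\<delta> / 4))"
    using content_ball_conv_unit_ball[of "\<delta> / 4" "0::real^'d"] content_ball_conv_unit_ball[of "\<delta> / 4" "e /\<^sub>R 2"] \<delta>
    by simp
  also have "\<dots> \<le> measure lborel {s *\<^sub>R x | s x. 0 < s \<and> s \<le> 1 \<and> x \<in> ?B}"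
  proof (rule measure_mono_fmeasurable)
    show "ball (e /\<^sub>R 2) (\<delta> / 4) \<subseteq> {s *\<^sub>R x | s x. 0 < s \<and> s \<le> 1 \<and> x \<in> ?B}"
    proof
      fix y assume "y \<in> ball (e /\<^sub>R 2) (\<delta> / 4)"
      then have y: "norm (y - e /\<^sub>R 2) < \<delta> / 4" by (simp add: dist_norm norm_minus_commute)
      have ny: "\<bar>norm y - 1 / 2\<bar> < \<delta> / 4"
        using norm_triangle_ineq3[of y "e /\<^sub>R 2"] y e by simp
      then have "norm y \<le> 1" "norm y > 0" using \<delta> by linarith+
      then have y0: "y \<noteq> 0" "norm y \<le> 1" by auto
      \<comment> \<open>Both terms have norm below \<delta>/2: the first by the estimate
        \<open>ny\<close> of the norm of \<open>y\<close>, the second by the choice of the radius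
        \<delta>/4.\<close>
      have "sphere_proj y - e = (1 - 2 * norm y) *\<^sub>R sphere_proj y + 2 *\<^sub>R (y - e /\<^sub>R 2)"
        using y0 by (simp add: sphere_proj_def algebra_simps)
      then have "norm (sphere_proj y - e) \<le> \<bar>1 - 2 * norm y\<bar> * norm (sphere_proj y) + 2 * norm (y - e /\<^sub>R 2)"
        by (metis norm_triangle_ineq norm_scaleR abs_numeral)
      also have "\<dots> = \<bar>1 - 2 * norm y\<bar> + 2 * norm (y - e /\<^sub>R 2)"
        using y0 by (simp add: sphere_proj_def)
      also have "\<dots> < \<delta>" using y ny by linarith
      finally show "y \<in> {s *\<^sub>R x | s x. 0 < s \<and> s \<le> 1 \<and> x \<in> ?B}"
        using y0 by (subst cone_eq) (auto simp: dist_norm norm_minus_commute sphere_proj_def)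
    qed
    have "{s *\<^sub>R x | s x. 0 < s \<and> s \<le> 1 \<and> x \<in> ?B} \<in> sets lborel"
      by (simp only: sets_lborel) (intro cone_borel, auto)
    then show "{s *\<^sub>R x | s x. 0 < s \<and> s \<le> 1 \<and> x \<in> ?B} \<in> fmeasurable lborel"
      by (rule fmeasurableI2[OF fmeasurable_compact[OF compact_cball[of 0 1]], rotated])
        (subst cone_eq, auto)
  qed simp
  finally show ?thesis
    by (simp add: sphere_unif_def divide_right_mono)
qed

subsection \<open>The transition operator\<close>

lemma borel_measurable_vec_nth: "(\<lambda>x::'b::topological_space^'m. x $ i) \<in> borel_measurable borel"
  by (intro borel_measurable_continuous_onI continuous_intros)

lemma party_step_measurable [measurable]:
  fixes \<eta> :: "'n::finite \<Rightarrow> 'n \<Rightarrow> real" and f :: "'a \<Rightarrow> real^'d^'n"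
  assumes [measurable]: "f \<in> borel_measurable N" "g \<in> borel_measurable N"
  shows "(\<lambda>w. party_step \<eta> (f w) (g w)) \<in> borel_measurable N"
proof -
  have [measurable]: "(\<lambda>w. f w $ i) \<in> borel_measurable N" for i
    by (rule measurable_compose[OF assms(1) borel_measurable_vec_nth])
  have [measurable]: "(sgn :: real \<Rightarrow> real) \<in> borel_measurable borel"
    by simp
  \<comment> \<open>Moving the sign condition from the index set into the summands leaves a sum over
    a fixed finite set, to which measurability rules apply.\<close>
  have unnorm: "party_unnorm \<eta> X \<xi> i = X $ i + (\<Sum>j\<in>UNIV. if sgn (X $ j \<bullet> \<xi>) = sgn (X $ i \<bullet> \<xi>)
      then \<eta> i j *\<^sub>R X $ j else - (\<eta> i j *\<^sub>R X $ j))" for X :: "real^'d^'n" and \<xi> i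
    unfolding party_unnorm_def
    by (subst sum.If_cases) (auto simp: Collect_neg_eq sum_negf)
  have [measurable]: "(\<lambda>w. sphere_proj (party_unnorm \<eta> (f w) (g w) i)) \<in> borel_measurable N" for i
    unfolding unnorm by measurable
  show ?thesis
    unfolding borel_measurable_euclidean_space[where 'c = "real^'d^'n"]
    by (auto simp: Basis_vec_def party_step_def inner_axis intro!: measurable_compose[OF _ borel_measurable_vec_nth])
qed

text \<open>The Markov operator of the chain. Its k-th iterate gives the expected value of
  \<open>f\<close> after k steps from \<open>X\<close>, with no path space attached to each
  start.\<close>

definition party_op :: "('n::finite \<Rightarrow> 'n \<Rightarrow> real) \<Rightarrow> (real^'d) measure \<Rightarrow> (real^'d^'n \<Rightarrow> real) \<Rightarrow> real^'d^'n \<Rightarrow> real"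
  where "party_op \<eta> D f X = (\<integral>\<xi>. f (party_step \<eta> X \<xi>) \<partial>D)"

text \<open>\<open>party_traj\<close> recurses on its last step; splitting off the first one matches
  the induction on iterates of \<open>party_op\<close>.\<close>

lemma party_traj_Suc_shift:
  "party_traj \<eta> X xs (Suc k) = party_traj \<eta> (party_step \<eta> X (xs 0)) (\<lambda>s. xs (Suc s)) k"
  by (induction k) auto

locale party_noise = prob_space D for D :: "(real^'d) measure" +
  assumes sets_D [measurable_cong]: "sets D = sets borel"
begin

lemma party_op_measurable [measurable]:
  fixes \<eta> :: "'n::finite \<Rightarrow> 'n \<Rightarrow> real"
  assumes [measurable]: "f \<in> borel_measurable borel"
  shows "party_op \<eta> D f \<in> borel_measurable borel"
  unfolding party_op_def by measurable

lemma party_op_integrable: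
  fixes \<eta> :: "'n::finite \<Rightarrow> 'n \<Rightarrow> real" and f :: "real^'d^'n \<Rightarrow> real"
  assumes [measurable]: "f \<in> borel_measurable borel" and "\<And>X. 0 \<le> f X" "\<And>X. f X \<le> 1"
  shows "integrable D (\<lambda>\<xi>. f (party_step \<eta> X \<xi>))"
proof (rule integrable_const_bound)
  show "AE \<xi> in D. norm (f (party_step \<eta> X \<xi>)) \<le> 1" using assms(2,3) by simp
qed measurable

lemma party_op_bounds:
  fixes \<eta> :: "'n::finite \<Rightarrow> 'n \<Rightarrow> real"
  assumes f: "f \<in> borel_measurable borel" "\<And>X. 0 \<le> f X" "\<And>X. f X \<le> 1"
  shows "0 \<le> party_op \<eta> D f X" "party_op \<eta> D f X \<le> 1"
proof -
  show "0 \<le> party_op \<eta> D f X" unfolding party_op_def using f(2) by (rule Bochner_Integration.integral_nonneg)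
  have "party_op \<eta> D f X \<le> (\<integral>\<xi>. 1 \<partial>D)"
    unfolding party_op_def by (rule integral_mono[OF party_op_integrable[OF f]]) (use f in auto)
  then show "party_op \<eta> D f X \<le> 1" by (simp add: prob_space)
qed

lemma party_op_funpow_props:
  fixes \<eta> :: "'n::finite \<Rightarrow> 'n \<Rightarrow> real"
  assumes f: "f \<in> borel_measurable borel" "\<And>X. 0 \<le> f X" "\<And>X. f X \<le> 1"
  shows "(party_op \<eta> D ^^ k) f \<in> borel_measurable borel \<and>
    (\<forall>X. 0 \<le> (party_op \<eta> D ^^ k) f X \<and> (party_op \<eta> D ^^ k) f X \<le> 1)"
  by (induction k) (auto simp: f intro!: party_op_bounds party_op_measurable)

lemma party_op_funpow_mono:
  fixes \<eta> :: "'n::finite \<Rightarrow> 'n \<Rightarrow> real"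
  assumes f: "f \<in> borel_measurable borel" "\<And>X. 0 \<le> f X" "\<And>X. f X \<le> 1"
    and g: "g \<in> borel_measurable borel" "\<And>X. 0 \<le> g X" "\<And>X. g X \<le> 1"
    and le: "\<And>X. f X \<le> g X"
  shows "(party_op \<eta> D ^^ k) f X \<le> (party_op \<eta> D ^^ k) g X"
proof (induction k arbitrary: X)
  case (Suc k)
  then show ?case
    using party_op_funpow_props[OF f] party_op_funpow_props[OF g]
    by (auto simp: party_op_def[of \<eta> D "(party_op \<eta> D ^^ k) _"] intro!: integral_mono party_op_integrable)
qed (simp add: le)

text \<open>With probability \<open>measure D G ^ k\<close> all k noises fall into \<open>G\<close>,
  and then \<open>f\<close> is at most \<open>v\<close>; otherwise only \<open>f \<le> 1\<close> is
  used. The induction conditions on the first noise.\<close>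

lemma party_op_funpow_le:
  fixes \<eta> :: "'n::finite \<Rightarrow> 'n \<Rightarrow> real"
  assumes f: "f \<in> borel_measurable borel" "\<And>X. 0 \<le> f X" "\<And>X. f X \<le> 1"
    and G: "G \<in> sets borel" "G \<noteq> {}"
    and good: "\<And>xs. (\<And>s. xs s \<in> G) \<Longrightarrow> f (party_traj \<eta> X xs k) \<le> v"
  shows "(party_op \<eta> D ^^ k) f X \<le> 1 - (1 - v) * measure D G ^ k"
  using good
proof (induction k arbitrary: X)
  case 0
  \<comment> \<open>The hypothesis speaks of infinite noise sequences, so even zero steps need some
    sequence in \<open>G\<close>; a constant one will do.\<close>
  obtain g where "g \<in> G" using G by auto
  then show ?case using 0[of "\<lambda>_. g"] by simp
next
  case (Suc k)
  let ?h = "(party_op \<eta> D ^^ k) f"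
  let ?c = "(1 - v) * measure D G ^ k"
  have h: "?h \<in> borel_measurable borel" "\<And>X. 0 \<le> ?h X" "\<And>X. ?h X \<le> 1"
    using party_op_funpow_props[OF f] by auto
  note [measurable] = G(1)
  have "?h (party_step \<eta> X \<xi>) \<le> 1 - ?c" if \<xi>: "\<xi> \<in> G" for \<xi>
  proof (rule Suc.IH)
    fix xs :: "nat \<Rightarrow> real^'d" assume xs: "\<And>s. xs s \<in> G"
    have "f (party_traj \<eta> X (case_nat \<xi> xs) (Suc k)) \<le> v"
      by (rule Suc.prems) (use \<xi> xs in \<open>auto split: nat.split\<close>)
    then show "f (party_traj \<eta> (party_step \<eta> X \<xi>) xs k) \<le> v"
      by (simp add: party_traj_Suc_shift del: party_traj.simps)
  qed
  moreover have intG: "integrable D (indicator G :: _ \<Rightarrow> real)"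
    by (simp add: integrable_indicator_iff sets_D G emeasure_eq_measure)
  ultimately have "party_op \<eta> D ?h X \<le> (\<integral>\<xi>. 1 - indicator G \<xi> * ?c \<partial>D)"
    unfolding party_op_def[of \<eta> D ?h]
    by (intro integral_mono party_op_integrable h Bochner_Integration.integrable_diff integrable_mult_left intG)
       (auto simp: indicator_def h)
  also have "\<dots> = 1 - measure D G * ?c"
    by (subst Bochner_Integration.integral_diff)
       (auto simp: prob_space intG measure_def[symmetric] sets_D G sets.Int_space_eq2)
  finally show ?case by (simp add: mult_ac)
qed

end

section \<open>Expected values along the random trajectory\<close>

lemma party_traj_cong:
  "(\<And>s. s < t \<Longrightarrow> xs s = ys s) \<Longrightarrow> party_traj \<eta> X xs t = party_traj \<eta> X ys t"
  by (induction t) auto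

lemma party_traj_measurable:
  fixes \<eta> :: "'n::finite \<Rightarrow> 'n \<Rightarrow> real" and X :: "real^'d^'n"
  assumes "\<And>s. s < t \<Longrightarrow> (\<lambda>w. xs w s) \<in> borel_measurable N"
  shows "(\<lambda>w. party_traj \<eta> X (xs w) t) \<in> borel_measurable N"
  using assms by (induction t) (auto intro!: party_step_measurable)

text \<open>The Markov property in integrated form: the state at time t is a function of the noises
  before t, which are independent of \<xi> t, so Fubini integrates out \<xi> t first.\<close>

lemma expectation_party_step:
  fixes \<eta> :: "'n::finite \<Rightarrow> 'n \<Rightarrow> real" and X0 :: "real^'d^'n" and \<xi> :: "nat \<Rightarrow> 'w \<Rightarrow> real^'d"
  assumes M: "prob_space M" and xi: "\<And>t. \<xi> t \<in> borel_measurable M"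
    and indep: "prob_space.indep_vars M (\<lambda>_. borel) \<xi> UNIV"
    and distr: "\<And>t. distr M borel (\<xi> t) = D" and D: "prob_space D"
    and f: "f \<in> borel_measurable borel" "\<And>X. 0 \<le> f X" "\<And>X. f X \<le> 1"
  shows "(\<integral>\<omega>. f (party_traj \<eta> X0 (\<lambda>s. \<xi> s \<omega>) (Suc t)) \<partial>M)
       = (\<integral>\<omega>. party_op \<eta> D f (party_traj \<eta> X0 (\<lambda>s. \<xi> s \<omega>) t) \<partial>M)"
proof -
  interpret M: prob_space M by fact
  have sets_D: "sets D = sets borel" using distr[of 0] by (metis sets_distr)
  interpret D: party_noise D by (intro party_noise.intro D party_noise_axioms.intro sets_D)
  \<comment> \<open>The past and the current noise are restrictions of the noise family to disjoint
    index sets, the form in which their independence is available.\<close>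
  let ?A = "\<lambda>\<omega>. restrict (\<lambda>i. \<xi> i \<omega>) {..<t}" and ?B = "\<lambda>\<omega>. restrict (\<lambda>i. \<xi> i \<omega>) {t}"
  let ?P = "PiM {..<t} (\<lambda>_. borel :: (real^'d) measure)" and ?Q = "PiM {t} (\<lambda>_. borel :: (real^'d) measure)"
  note [measurable] = f(1) xi
  have traj [measurable]: "(\<lambda>g. party_traj \<eta> X0 g t) \<in> borel_measurable ?P"
    by (intro party_traj_measurable) auto
  have "M.indep_var ?P ?A ?Q ?B"
    by (rule M.indep_var_restrict[OF indep]) auto
  then have AB [measurable]: "?A \<in> measurable M ?P" "?B \<in> measurable M ?Q"
    and joint: "distr M ?P ?A \<Otimes>\<^sub>M distr M ?Q ?B = distr M (?P \<Otimes>\<^sub>M ?Q) (\<lambda>\<omega>. (?A \<omega>, ?B \<omega>))"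
    by (auto simp: M.indep_var_distribution_eq)
  interpret A: prob_space "distr M ?P ?A" by (rule M.prob_space_distr) (rule AB)
  interpret B: prob_space "distr M ?Q ?B" by (rule M.prob_space_distr) (rule AB)
  interpret AB: pair_prob_space "distr M ?P ?A" "distr M ?Q ?B" ..
  have traj_A: "party_traj \<eta> X0 (?A \<omega>) t = party_traj \<eta> X0 (\<lambda>s. \<xi> s \<omega>) t" for \<omega>
    by (rule party_traj_cong) simp
  have B_t: "?B \<omega> t = \<xi> t \<omega>" for \<omega> by simp
  define F where "F a b = f (party_step \<eta> (party_traj \<eta> X0 a t) (b t))" for a b
  have F [measurable]: "case_prod F \<in> borel_measurable (?P \<Otimes>\<^sub>M ?Q)"
    unfolding F_def by measurable
  have inner: "(\<integral>b. F a b \<partial>distr M ?Q ?B) = party_op \<eta> D f (party_traj \<eta> X0 a t)" for a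
  proof -
    have [measurable]: "F a \<in> borel_measurable ?Q" unfolding F_def by measurable
    have "(\<integral>b. F a b \<partial>distr M ?Q ?B) = (\<integral>\<omega>. f (party_step \<eta> (party_traj \<eta> X0 a t) (\<xi> t \<omega>)) \<partial>M)"
      by (subst integral_distr) (auto simp: F_def)
    also have "\<dots> = (\<integral>x. f (party_step \<eta> (party_traj \<eta> X0 a t) x) \<partial>distr M borel (\<xi> t))"
      by (subst integral_distr) auto
    finally show ?thesis by (simp add: party_op_def distr)
  qed
  have "(\<integral>\<omega>. f (party_traj \<eta> X0 (\<lambda>s. \<xi> s \<omega>) (Suc t)) \<partial>M)
      = (\<integral>p. case_prod F p \<partial>(distr M ?P ?A \<Otimes>\<^sub>M distr M ?Q ?B))"
    unfolding joint by (subst integral_distr) (auto simp: F_def traj_A B_t simp del: restrict_apply)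
  also have "\<dots> = (\<integral>a. (\<integral>b. F a b \<partial>distr M ?Q ?B) \<partial>distr M ?P ?A)"
  proof (subst AB.integral_fst'[symmetric])
    show "integrable (distr M ?P ?A \<Otimes>\<^sub>M distr M ?Q ?B) (case_prod F)"
    proof (rule AB.integrable_const_bound)
      show "AE p in distr M ?P ?A \<Otimes>\<^sub>M distr M ?Q ?B. norm (case_prod F p) \<le> 1"
        using f by (auto simp: F_def split: prod.split)
    qed measurable
  qed simp
  also have "\<dots> = (\<integral>\<omega>. party_op \<eta> D f (party_traj \<eta> X0 (\<lambda>s. \<xi> s \<omega>) t) \<partial>M)"
    unfolding inner
    by (subst integral_distr)
       (auto simp: traj_A simp del: restrict_apply intro!: measurable_compose[OF traj D.party_op_measurable] f)
  finally show ?thesis .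
qed

lemma expectation_party_funpow:
  fixes \<eta> :: "'n::finite \<Rightarrow> 'n \<Rightarrow> real" and X0 :: "real^'d^'n" and \<xi> :: "nat \<Rightarrow> 'w \<Rightarrow> real^'d"
  assumes M: "prob_space M" and xi: "\<And>t. \<xi> t \<in> borel_measurable M"
    and indep: "prob_space.indep_vars M (\<lambda>_. borel) \<xi> UNIV"
    and distr: "\<And>t. distr M borel (\<xi> t) = D" and D: "prob_space D"
    and f: "f \<in> borel_measurable borel" "\<And>X. 0 \<le> f X" "\<And>X. f X \<le> 1"
  shows "(\<integral>\<omega>. f (party_traj \<eta> X0 (\<lambda>s. \<xi> s \<omega>) (t + k)) \<partial>M)
       = (\<integral>\<omega>. (party_op \<eta> D ^^ k) f (party_traj \<eta> X0 (\<lambda>s. \<xi> s \<omega>) t) \<partial>M)"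
proof (induction k arbitrary: t)
  case (Suc k)
  have sets_D: "sets D = sets borel" using distr[of 0] by (metis sets_distr)
  interpret D: party_noise D by (intro party_noise.intro D party_noise_axioms.intro sets_D)
  let ?g = "(party_op \<eta> D ^^ k) f"
  have "(\<integral>\<omega>. f (party_traj \<eta> X0 (\<lambda>s. \<xi> s \<omega>) (t + Suc k)) \<partial>M) = (\<integral>\<omega>. ?g (party_traj \<eta> X0 (\<lambda>s. \<xi> s \<omega>) (Suc t)) \<partial>M)"
    using Suc[of "Suc t"] by (simp del: party_traj.simps)
  also have "\<dots> = (\<integral>\<omega>. party_op \<eta> D ?g (party_traj \<eta> X0 (\<lambda>s. \<xi> s \<omega>) t) \<partial>M)"
    using D.party_op_funpow_props[OF f]
    by (intro expectation_party_step M xi indep distr D) auto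
  finally show ?case by simp
qed simp

subsection \<open>The Lyapunov function\<close>

text \<open>Configurations off the sphere get the value 1, so that the \<open>L\<close>-step operator does not increase
  the potential anywhere.\<close>

definition polar_potential :: "real \<Rightarrow> real^'d^'n::finite \<Rightarrow> real" where
  "polar_potential \<epsilon> X = (if \<forall>j. norm (X $ j) = 1 then min 1 (infdist X polarized_set / \<epsilon>) else 1)"

lemma polar_potential_bounds:
  assumes "0 < \<epsilon>"
  shows "0 \<le> polar_potential \<epsilon> X" "polar_potential \<epsilon> X \<le> 1"
  using assms by (auto simp: polar_potential_def infdist_nonneg)

lemma polar_potential_measurable: "(polar_potential \<epsilon> :: real^'d^'n::finite \<Rightarrow> real) \<in> borel_measurable borel"
proof -
  have "closed {X :: real^'d^'n. \<forall>j. norm (X $ j) = 1}"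
    by (intro closed_Collect_all closed_Collect_eq continuous_intros)
  then have "Measurable.pred borel (\<lambda>X :: real^'d^'n. \<forall>j. norm (X $ j) = 1)"
    by (simp add: pred_def borel_closed)
  moreover have "(\<lambda>X :: real^'d^'n. infdist X polarized_set) \<in> borel_measurable borel"
    by (intro borel_measurable_continuous_onI continuous_on_infdist continuous_on_id)
  ultimately show ?thesis unfolding polar_potential_def by measurable
qed

section \<open>Probabilities of bands and caps, and the drift inequality\<close>

locale spherical_noise = party_noise D for D :: "(real^'d) measure" +
  fixes C C' :: real
  assumes sphere_1: "measure D (sphere 0 1) = 1"
    and C_pos: "C > 0" and C'_pos: "C' > 0"
    and bounds: "\<And>B. B \<in> sets borel \<Longrightarrow> B \<subseteq> sphere 0 1 \<Longrightarrow>
                     C * sphere_unif B \<le> measure D B \<and> measure D B \<le> C' * sphere_unif B"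
begin

lemma slab_borel: "{x \<in> sphere 0 1. \<bar>x \<bullet> e\<bar> \<le> r} \<in> sets borel" for e :: "real^'d"
  unfolding mem_sphere_0
  by (intro borel_closed closed_Collect_conj closed_Collect_le closed_Collect_eq continuous_intros)

lemma prob_slab_le:
  obtains K where "0 < K"
    "\<And>e r. norm e = 1 \<Longrightarrow> 0 \<le> r \<Longrightarrow> measure D {x \<in> sphere 0 1. \<bar>x \<bullet> e\<bar> \<le> r} \<le> K * r"
proof
  let ?V = "6 * measure lborel (cball (0::real^'d) 2) / measure lborel (cball (0::real^'d) 1)"
  show "0 < C' * ?V"
    using C'_pos measure_cball_pos[of 1, where 'd = 'd] measure_cball_pos[of 2, where 'd = 'd] by simp
  fix e :: "real^'d" and r :: real assume "norm e = 1" "0 \<le> r"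
  then have "C' * sphere_unif {x \<in> sphere 0 1. \<bar>x \<bullet> e\<bar> \<le> r} \<le> C' * (?V * r)"
    using C'_pos by (intro mult_left_mono sphere_unif_slab_le) auto
  moreover have "measure D {x \<in> sphere 0 1. \<bar>x \<bullet> e\<bar> \<le> r} \<le> C' * sphere_unif {x \<in> sphere 0 1. \<bar>x \<bullet> e\<bar> \<le> r}"
    using bounds[OF slab_borel] by blast
  ultimately show "measure D {x \<in> sphere 0 1. \<bar>x \<bullet> e\<bar> \<le> r} \<le> C' * ?V * r"
    by (simp only: mult.assoc)
qed

lemma prob_cap_ge:
  assumes "0 < \<delta>" "\<delta> \<le> 1"
  obtains g where "0 < g" "\<And>e. norm e = 1 \<Longrightarrow> g \<le> measure D (sphere 0 1 \<inter> ball e \<delta>)"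
proof
  let ?V = "measure lborel (ball (0::real^'d) (\<delta> / 4)) / measure lborel (cball (0::real^'d) 1)"
  show "0 < C * ?V"
    using C_pos measure_cball_pos[of 1, where 'd = 'd] content_ball_pos[of "\<delta> / 4" "0::real^'d"] assms by simp
  fix e :: "real^'d" assume "norm e = 1"
  then have "C * ?V \<le> C * sphere_unif (sphere 0 1 \<inter> ball e \<delta>)"
    using C_pos assms by (intro mult_left_mono sphere_unif_cap_ge) auto
  also have "\<dots> \<le> measure D (sphere 0 1 \<inter> ball e \<delta>)" using bounds by auto
  finally show "C * ?V \<le> measure D (sphere 0 1 \<inter> ball e \<delta>)" .
qed

text \<open>A union bound with the noise law itself as the random choice: each agent excludes a band
  of probability at most K * \<delta>, and \<delta> is chosen so that the n bands together have
  probability at most 1/2.\<close>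

lemma exists_separating_direction:
  obtains \<delta> where "0 < \<delta>" "\<delta> \<le> 1"
    "\<And>X :: real^'d^'n::finite. (\<And>j. norm (X $ j) = 1) \<Longrightarrow> \<exists>e. norm e = 1 \<and> (\<forall>j. \<delta> \<le> \<bar>X $ j \<bullet> e\<bar>)"
proof -
  obtain K where K: "0 < K"
    and slab: "\<And>e r. norm e = 1 \<Longrightarrow> 0 \<le> r \<Longrightarrow> measure D {x \<in> sphere 0 1. \<bar>x \<bullet> e\<bar> \<le> r} \<le> K * r"
    using prob_slab_le by blast
  define \<delta> where "\<delta> = min 1 (1 / (2 * real CARD('n) * K))"
  have "K * \<delta> \<le> K * (1 / (2 * real CARD('n) * K))"
    using K by (intro mult_left_mono) (auto simp: \<delta>_def)
  then have K\<delta>: "real CARD('n) * (K * \<delta>) \<le> real CARD('n) * (1 / (2 * real CARD('n)))"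
    using K by (intro mult_left_mono) (auto simp: field_simps)
  show thesis
  proof (rule that[of \<delta>])
    show "0 < \<delta>" "\<delta> \<le> 1" using K by (auto simp: \<delta>_def)
    fix X :: "real^'d^'n" assume X: "\<And>j. norm (X $ j) = 1"
    define B where "B j = {x \<in> sphere 0 1. \<bar>x \<bullet> X $ j\<bar> \<le> \<delta>}" for j
    have "measure D (\<Union>j\<in>UNIV. B j) \<le> (\<Sum>j\<in>UNIV. measure D (B j))"
      by (intro finite_measure_subadditive_finite) (auto simp: B_def sets_D slab_borel)
    also have "\<dots> \<le> (\<Sum>j\<in>(UNIV :: 'n set). K * \<delta>)"
      unfolding B_def using \<open>0 < \<delta>\<close> X by (intro sum_mono slab) auto
    also have "\<dots> < 1" using K\<delta> by simp
    finally have "(\<Union>j\<in>UNIV. B j) \<noteq> sphere 0 1" using sphere_1 by auto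
    moreover have "(\<Union>j\<in>UNIV. B j) \<subseteq> sphere 0 1" by (auto simp: B_def)
    ultimately obtain e where "e \<in> sphere 0 1" "\<forall>j. e \<notin> B j" by blast
    then show "\<exists>e. norm e = 1 \<and> (\<forall>j. \<delta> \<le> \<bar>X $ j \<bullet> e\<bar>)"
      by (intro exI[of _ e]) (auto simp: B_def inner_commute not_le intro: less_imp_le)
  qed
qed

text \<open>Near the polarized set the gain shows after L steps, far from it only over a longer
  block. A common horizon T works because the expected potential never rises over L steps, so the
  near gain persists until T.\<close>

lemma polar_potential_drift:
  fixes \<eta> :: "'n::finite \<Rightarrow> 'n \<Rightarrow> real"
  assumes eta: "\<And>i j. 0 \<le> \<eta> i j"
    and irred: "\<And>i j. matpow (adj_matrix \<eta>) CARD('n) $ i $ j > 0"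
  shows "\<exists>\<epsilon> T c. 0 < \<epsilon> \<and> c < 1 \<and>
    (\<forall>X :: real^'d^'n. (\<forall>j. norm (X $ j) = 1) \<longrightarrow>
      (party_op \<eta> D ^^ T) (polar_potential \<epsilon>) X \<le> c * polar_potential \<epsilon> X)"
proof -
  obtain K where K: "0 < K"
    and slab: "\<And>e r. norm e = 1 \<Longrightarrow> 0 \<le> r \<Longrightarrow> measure D {x \<in> sphere 0 1. \<bar>x \<bullet> e\<bar> \<le> r} \<le> K * r"
    using prob_slab_le by blast
  obtain m where m: "0 < m" and near: "\<And>X :: real^'d^'n. \<lbrakk>\<And>j. norm (X $ j) = 1; infdist X polarized_set \<le> 1\<rbrakk>
      \<Longrightarrow> \<exists>e. norm e = 1 \<and> (\<forall>xs. (\<forall>s. norm (xs s) = 1 \<and> infdist X polarized_set < \<bar>xs s \<bullet> e\<bar>) \<longrightarrow>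
             (\<forall>j. norm (party_traj \<eta> X xs (CARD('n) * m) $ j) = 1) \<and>
             infdist (party_traj \<eta> X xs (CARD('n) * m)) polarized_set \<le> infdist X polarized_set / 4)"
    using contraction_near_polarized[where 'd = 'd, of \<eta>] eta irred by blast
  define L where "L = CARD('n) * m"
  have L: "0 < L" using m by (simp add: L_def)
  \<comment> \<open>A block of L steps meets a bad noise with probability at most L * K * r; this
    \<epsilon> makes that at most a quarter of the potential r / \<epsilon>.\<close>
  define \<epsilon> where "\<epsilon> = min 1 (1 / (4 * real L * K))"
  have "real L * K * \<epsilon> \<le> real L * K * (1 / (4 * real L * K))"
    using K L by (intro mult_left_mono) (auto simp: \<epsilon>_def)
  also have "\<dots> = 1 / 4" using K L by simp
  finally have \<epsilon>: "0 < \<epsilon>" "\<epsilon> \<le> 1" "real L * K * \<epsilon> \<le> 1 / 4" using K L by (auto simp: \<epsilon>_def)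
  define V where "V = (polar_potential \<epsilon> :: real^'d^'n \<Rightarrow> real)"
  have V: "V \<in> borel_measurable borel" "\<And>X. 0 \<le> V X" "\<And>X. V X \<le> 1"
    unfolding V_def using polar_potential_measurable polar_potential_bounds[OF \<epsilon>(1)] by auto
  let ?P = "\<lambda>k. (party_op \<eta> D ^^ k) V"
  note P = party_op_funpow_props[OF V]
  \<comment> \<open>One quarter of the potential remains after a good block, and the probability of
    a bad block, where the potential is at most 1, adds at most another quarter.\<close>
  have contr: "?P L X \<le> V X / 2" if X: "\<And>j. norm (X $ j) = 1" and r\<epsilon>: "infdist X polarized_set < \<epsilon>" for X
  proof -
    define r where "r = infdist X polarized_set"
    have r: "0 \<le> r" "r < \<epsilon>" "r \<le> 1" using r\<epsilon> \<epsilon> by (auto simp: r_def infdist_nonneg)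
    have VX: "V X = r / \<epsilon>" using X r \<epsilon> by (auto simp: V_def polar_potential_def r_def)
    obtain e where e: "norm e = 1" and
      path: "\<And>xs. (\<And>s. norm (xs s) = 1 \<and> r < \<bar>xs s \<bullet> e\<bar>) \<Longrightarrow>
             (\<forall>j. norm (party_traj \<eta> X xs L $ j) = 1) \<and>
             infdist (party_traj \<eta> X xs L) polarized_set \<le> r / 4"
      using near[of X] X r(3) unfolding r_def L_def by blast
    define B where "B = {x \<in> sphere 0 1. \<bar>x \<bullet> e\<bar> \<le> r}"
    define G where "G = sphere 0 1 - B"
    have B: "B \<in> sets D" unfolding B_def sets_D by (rule slab_borel)
    have "measure D G = 1 - measure D B"
      unfolding G_def using B sphere_1 by (subst finite_measure_Diff) (auto simp: B_def sets_D)
    moreover have pB: "measure D B \<le> K * r" unfolding B_def by (rule slab[OF e r(1)])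
    ultimately have pG: "1 - K * r \<le> measure D G" by simp
    have Kr: "real L * (K * r) \<le> 1 / 4"
    proof -
      have "real L * K * r \<le> real L * K * \<epsilon>" using r K by (intro mult_left_mono) auto
      then show ?thesis using \<epsilon>(3) by (simp add: mult.assoc)
    qed
    have "1 * (K * r) \<le> real L * (K * r)" using L K r by (intro mult_right_mono) auto
    then have Kr1: "K * r \<le> 1 / 4" using Kr by simp
    have "?P L X \<le> 1 - (1 - V X / 4) * measure D G ^ L"
    proof (rule party_op_funpow_le[OF V])
      show "G \<in> sets borel" using B by (auto simp: G_def sets_D)
      show "G \<noteq> {}" using pG Kr1 by auto
      fix xs :: "nat \<Rightarrow> real^'d" assume xs: "\<And>s. xs s \<in> G"
      have "norm (xs s) = 1 \<and> r < \<bar>xs s \<bullet> e\<bar>" for s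
        using xs[of s] by (auto simp: G_def B_def)
      note p = path[of xs, OF this]
      then have "infdist (party_traj \<eta> X xs L) polarized_set / \<epsilon> \<le> (r / 4) / \<epsilon>"
        using \<epsilon>(1) by (intro divide_right_mono) auto
      then have "V (party_traj \<eta> X xs L) \<le> (r / 4) / \<epsilon>"
        using p unfolding V_def polar_potential_def by (simp only: min.coboundedI2 simp_thms if_True)
      then show "V (party_traj \<eta> X xs L) \<le> V X / 4" by (simp add: VX)
    qed
    also have "\<dots> \<le> 1 - (1 - V X / 4) * (1 - real L * (K * r))"
    proof -
      have "1 + real L * (- (K * r)) \<le> (1 + - (K * r)) ^ L"
        by (rule Bernoulli_inequality) (use Kr1 in simp)
      also have "\<dots> \<le> measure D G ^ L" using pG Kr1 by (intro power_mono) auto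
      finally show ?thesis using V(3)[of X] by (intro diff_left_mono mult_left_mono) auto
    qed
    also have "\<dots> \<le> V X / 4 + real L * (K * r)"
      using V(2)[of X] K r by (simp add: algebra_simps)
    also have "real L * (K * r) = (real L * K * \<epsilon>) * V X" using \<epsilon> by (simp add: VX)
    also have "\<dots> \<le> 1 / 4 * V X" using \<epsilon> V(2) by (intro mult_right_mono) auto
    finally show ?thesis by simp
  qed
  \<comment> \<open>Outside the near regime the potential already has its maximal value 1, so there
    is nothing to lose there.\<close>
  have super: "?P L X \<le> V X" for X
  proof (cases "(\<forall>j. norm (X $ j) = 1) \<and> infdist X polarized_set < \<epsilon>")
    case True
    then show ?thesis using contr[of X] V(2)[of X] by auto
  next
    case False
    then have "V X = 1" using \<epsilon>(1) by (auto simp: V_def polar_potential_def)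
    then show ?thesis using P by auto
  qed
  have decr: "?P (L * Suc k) X \<le> ?P L X" for k X
  proof (induction k)
    case (Suc k)
    have "?P (L * Suc (Suc k)) X = (party_op \<eta> D ^^ (L * Suc k)) (?P L) X"
      by (simp add: funpow_add[symmetric, THEN fun_cong, unfolded o_def] add.commute[of L])
    also have "\<dots> \<le> ?P (L * Suc k) X"
      using P super by (intro party_op_funpow_mono V) auto
    finally show ?case using Suc by simp
  qed simp
  obtain \<delta> where \<delta>: "0 < \<delta>" "\<delta> \<le> 1" and sep:
    "\<And>X :: real^'d^'n. (\<And>j. norm (X $ j) = 1) \<Longrightarrow> \<exists>e. norm e = 1 \<and> (\<forall>j. \<delta> \<le> \<bar>X $ j \<bullet> e\<bar>)"
    using exists_separating_direction by blast
  obtain N where far: "\<And>(X :: real^'d^'n) e xs m. \<lbrakk>N \<le> m; \<And>j. norm (X $ j) = 1; norm e = 1; \<And>j. \<delta> \<le> \<bar>X $ j \<bullet> e\<bar>;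
        \<And>s. xs s \<in> ball e (\<delta> / 2)\<rbrakk>
      \<Longrightarrow> (\<forall>j. norm (party_traj \<eta> X xs (CARD('n) * m) $ j) = 1) \<and>
          infdist (party_traj \<eta> X xs (CARD('n) * m)) polarized_set \<le> \<epsilon> / 2"
    by (rule contraction_far[where 'd = 'd, of \<eta> \<delta> "\<epsilon> / 2"]) (use eta irred \<delta> \<epsilon> in auto)
  obtain g where g: "0 < g" and cap: "\<And>e. norm e = 1 \<Longrightarrow> g \<le> measure D (sphere 0 1 \<inter> ball e (\<delta> / 2))"
    by (rule prob_cap_ge[of "\<delta> / 2"]) (use \<delta> in auto)
  \<comment> \<open>As a multiple of L this horizon admits \<open>decr\<close>; as n times a number
    of rounds at least \<open>N\<close> it admits \<open>far\<close>.\<close>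
  define T where "T = L * Suc N"
  have T: "T = CARD('n) * (m * Suc N)" by (simp add: T_def L_def algebra_simps)
  have N_le: "N \<le> m * Suc N" using m by (metis Suc_leD le_refl mult_le_mono1 mult_1 Suc_leI One_nat_def)
  have P_far: "?P T X \<le> 1 - g ^ T / 2" if X: "\<And>j. norm (X $ j) = 1" for X
  proof -
    obtain e where e: "norm e = 1" "\<And>j. \<delta> \<le> \<bar>X $ j \<bullet> e\<bar>" using sep[of X] X by blast
    let ?G = "sphere 0 1 \<inter> ball e (\<delta> / 2)"
    have "?P T X \<le> 1 - (1 - 1 / 2) * measure D ?G ^ T"
    proof (rule party_op_funpow_le[OF V])
      show "?G \<in> sets borel" by auto
      show "?G \<noteq> {}" using cap[OF e(1)] g by auto
      fix xs :: "nat \<Rightarrow> real^'d" assume "\<And>s. xs s \<in> ?G"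
      then have "(\<forall>j. norm (party_traj \<eta> X xs T $ j) = 1) \<and> infdist (party_traj \<eta> X xs T) polarized_set \<le> \<epsilon> / 2"
        unfolding T by (intro far[OF N_le X e]) auto
      then have "V (party_traj \<eta> X xs T) \<le> infdist (party_traj \<eta> X xs T) polarized_set / \<epsilon>"
        and "infdist (party_traj \<eta> X xs T) polarized_set / \<epsilon> \<le> 1 / 2"
        using \<epsilon>(1) by (auto simp: V_def polar_potential_def field_simps)
      then show "V (party_traj \<eta> X xs T) \<le> 1 / 2" by (rule order_trans)
    qed
    moreover have "g ^ T \<le> measure D ?G ^ T" using g cap[OF e(1)] by (intro power_mono) auto
    ultimately show ?thesis by simp
  qed
  define c where "c = max (1 / 2) (1 - g ^ T / 2)"
  have c: "c < 1" using g by (auto simp: c_def)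
  have "?P T X \<le> c * V X" if X: "\<And>j. norm (X $ j) = 1" for X
  proof (cases "infdist X polarized_set < \<epsilon>")
    case True
    have "?P T X \<le> ?P L X" unfolding T_def by (rule decr)
    also have "\<dots> \<le> 1 / 2 * V X" using contr[OF X True] by simp
    also have "\<dots> \<le> c * V X" using V(2) by (intro mult_right_mono) (auto simp: c_def)
    finally show ?thesis .
  next
    case False
    then have "V X = 1" using \<epsilon>(1) by (auto simp: V_def polar_potential_def)
    then show ?thesis using P_far[OF X] by (simp add: c_def)
  qed
  then show ?thesis using \<epsilon>(1) c unfolding V_def by blast
qed

end

section \<open>Almost sure convergence\<close>

text \<open>A partial sum S is at most the sum of the first T terms plus c * S; solving for S gives
  a bound independent of its length.\<close>

lemma summable_of_block_contraction:
  fixes a :: "nat \<Rightarrow> real"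
  assumes a: "\<And>t. 0 \<le> a t" and contr: "\<And>t. a (t + T) \<le> c * a t" and c: "c < 1"
  shows "summable a"
proof (rule bounded_imp_summable)
  fix n
  have "(\<Sum>t\<le>n. a t) \<le> (\<Sum>t<Suc n + T. a t)"
    using a by (intro sum_mono2) auto
  also have "\<dots> = (\<Sum>t<T. a t) + (\<Sum>t\<le>n. a (t + T))"
  proof -
    have "(\<Sum>t<T + N. a t) = (\<Sum>t<T. a t) + (\<Sum>t<N. a (t + T))" for N
      by (induction N) (auto simp: add.commute)
    from this[of "Suc n"] show ?thesis by (simp add: lessThan_Suc_atMost add.commute)
  qed
  also have "\<dots> \<le> (\<Sum>t<T. a t) + c * (\<Sum>t\<le>n. a t)"
    unfolding sum_distrib_left by (intro add_left_mono sum_mono contr)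
  finally show "(\<Sum>t\<le>n. a t) \<le> (\<Sum>t<T. a t) / (1 - c)"
    using c by (simp add: field_simps)
qed (rule a)

theorem theorem3p7:
  fixes \<eta> :: "'n::finite \<Rightarrow> 'n \<Rightarrow> real"
    and X0 :: "real^'d^'n"
    and M :: "'w measure"
    and \<xi> :: "nat \<Rightarrow> 'w \<Rightarrow> real^'d"
    and D :: "(real^'d) measure"
    and C C' :: real
  assumes eta_nonneg: "\<And>i j. \<eta> i j \<ge> 0"
    and irred: "\<And>i j. matpow (adj_matrix \<eta>) CARD('n) $ i $ j > 0"
    and X0_sphere: "\<And>i. X0 $ i \<in> sphere 0 1"
    and M: "prob_space M"
    and D_sets: "sets D = sets borel"
    and D_prob: "prob_space D"
    and D_sphere: "measure D (sphere 0 1) = 1"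
    and C_pos: "C > 0" and C'_pos: "C' > 0"
    and D_bounds: "\<And>B. B \<in> sets borel \<Longrightarrow> B \<subseteq> sphere 0 1 \<Longrightarrow>
                     C * sphere_unif B \<le> measure D B \<and> measure D B \<le> C' * sphere_unif B"
    and xi_meas: "\<And>t. \<xi> t \<in> borel_measurable M"
    and xi_indep: "prob_space.indep_vars M (\<lambda>_. borel) \<xi> UNIV"
    and xi_distr: "\<And>t. distr M borel (\<xi> t) = D"
    and well_defined: "AE \<omega> in M. \<forall>t i.
                          party_unnorm \<eta> (party_traj \<eta> X0 (\<lambda>s. \<xi> s \<omega>) t) (\<xi> t \<omega>) i \<noteq> 0"
  shows "AE \<omega> in M. (\<lambda>t. infdist (party_traj \<eta> X0 (\<lambda>s. \<xi> s \<omega>) t) polarized_set) \<longlonglongrightarrow> 0"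
proof -
  interpret M: prob_space M by fact
  interpret spherical_noise D C C'
  proof -
    interpret prob_space D by fact
    show "spherical_noise D C C'"
      by unfold_locales (fact D_sets D_sphere C_pos C'_pos D_bounds)+
  qed
  obtain \<epsilon> T c where \<epsilon>: "0 < \<epsilon>" and c: "c < 1"
    and drift: "\<And>X :: real^'d^'n. \<forall>j. norm (X $ j) = 1
      \<Longrightarrow> (party_op \<eta> D ^^ T) (polar_potential \<epsilon>) X \<le> c * polar_potential \<epsilon> X"
    using polar_potential_drift[where \<eta> = \<eta>, OF eta_nonneg irred] by blast
  let ?X = "\<lambda>t \<omega>. party_traj \<eta> X0 (\<lambda>s. \<xi> s \<omega>) t"
  define V where "V = (polar_potential \<epsilon> :: real^'d^'n \<Rightarrow> real)"
  have V: "V \<in> borel_measurable borel" "\<And>X. 0 \<le> V X" "\<And>X. V X \<le> 1"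
    unfolding V_def using polar_potential_measurable polar_potential_bounds[OF \<epsilon>(1)] by auto
  have X_meas [measurable]: "?X t \<in> borel_measurable M" for t
    by (intro party_traj_measurable xi_meas)
  have VX_meas [measurable]: "(\<lambda>\<omega>. V (?X t \<omega>)) \<in> borel_measurable M" for t
    by (rule measurable_compose[OF X_meas V(1)])
  have int: "integrable M (\<lambda>\<omega>. f (?X t \<omega>))"
    if f: "f \<in> borel_measurable borel" "\<And>X. 0 \<le> f X" "\<And>X. f X \<le> 1" for f :: "real^'d^'n \<Rightarrow> real" and t
  proof (rule M.integrable_const_bound)
    show "AE \<omega> in M. norm (f (?X t \<omega>)) \<le> 1" using f by simp
  qed (rule measurable_compose[OF X_meas f(1)])
  \<comment> \<open>The nonvanishing assumption enters here: since \<open>sphere_proj 0 = 0\<close>,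
    a vanishing sum would take an opinion off the sphere.\<close>
  have unit: "AE \<omega> in M. \<forall>t j. norm (?X t \<omega> $ j) = 1"
    using well_defined
  proof eventually_elim
    case (elim \<omega>)
    show ?case
    proof (intro allI)
      fix t j show "norm (?X t \<omega> $ j) = 1"
        using X0_sphere elim by (cases t) (auto simp: party_step_def norm_sphere_proj)
    qed
  qed
  define a where "a t = (\<integral>\<omega>. V (?X t \<omega>) \<partial>M)" for t
  have a_nonneg: "0 \<le> a t" for t unfolding a_def using V by simp
  have "a (t + T) \<le> c * a t" for t
  proof -
    have "a (t + T) = (\<integral>\<omega>. (party_op \<eta> D ^^ T) V (?X t \<omega>) \<partial>M)"
      unfolding a_def by (rule expectation_party_funpow[OF M xi_meas xi_indep xi_distr D_prob V])
    also have "\<dots> \<le> (\<integral>\<omega>. c * V (?X t \<omega>) \<partial>M)"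
    proof (rule integral_mono_AE)
      show "AE \<omega> in M. (party_op \<eta> D ^^ T) V (?X t \<omega>) \<le> c * V (?X t \<omega>)"
        using unit by eventually_elim (auto simp: V_def intro!: drift)
    qed (use party_op_funpow_props[OF V] in \<open>auto intro!: int V\<close>)
    finally show ?thesis by (simp add: a_def)
  qed
  then have summable_a: "summable a" using a_nonneg c by (intro summable_of_block_contraction[of a T c])
  \<comment> \<open>Monotone convergence exchanges sum and expectation. The total potential has
    finite expectation, so it is almost surely finite and its terms tend to 0.\<close>
  have "(\<integral>\<^sup>+\<omega>. (\<Sum>t. ennreal (V (?X t \<omega>))) \<partial>M) = (\<Sum>t. ennreal (a t))"
    unfolding a_def using V
    by (subst nn_integral_suminf) (auto intro!: suminf_cong nn_integral_eq_integral int)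
  also have "\<dots> \<noteq> \<infinity>"
    using suminf_ennreal2[OF a_nonneg summable_a] by simp
  finally have "AE \<omega> in M. (\<Sum>t. ennreal (V (?X t \<omega>))) \<noteq> \<infinity>"
    by (rule nn_integral_PInf_AE[rotated]) measurable
  then show ?thesis
    using unit
  proof eventually_elim
    case (elim \<omega>)
    have "summable (\<lambda>t. V (?X t \<omega>))"
      by (rule summable_suminf_not_top) (use V elim in auto)
    then have V0: "(\<lambda>t. V (?X t \<omega>)) \<longlonglongrightarrow> 0" by (rule summable_LIMSEQ_zero)
    \<comment> \<open>Once the potential is below 1 its truncation is inactive, and it equals the
      distance divided by \<epsilon>.\<close>
    then have "\<forall>\<^sub>F t in sequentially. V (?X t \<omega>) < 1" by (rule order_tendstoD(2)) simp
    then have "\<forall>\<^sub>F t in sequentially. \<epsilon> * V (?X t \<omega>) = infdist (?X t \<omega>) polarized_set"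
      by eventually_elim (use elim \<epsilon> in \<open>auto simp: V_def polar_potential_def min_def split: if_splits\<close>)
    moreover have "(\<lambda>t. \<epsilon> * V (?X t \<omega>)) \<longlonglongrightarrow> \<epsilon> * 0" by (intro tendsto_intros V0)
    ultimately show ?case by (simp add: tendsto_cong)
  qed
qed

end
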